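(* Let $k$ be a field and $n\ge3$. For every $i$ with $0\le i\le n-1$ and every $g\in G_{\mathbf s,\mathbf t}$ we have $$(L_{\mathbf s}L_{\mathbf t})^{g^{-1}Hg}=K(u_0^g,\ldots,u_{n-1}^g)=K(v_0^g,\ldots,v_{n-1}^g)=K(u_i^g)=K(v_i^g),$$ and $[K(u_i^g):K]=n!$.
   Context: Let $x_1,\ldots,x_n,y_1,\ldots,y_n$ be independent variables over $k$; let $s_i$ (resp. $t_i$) be the $i$-th elementary symmetric function of $\mathbf x=(x_1,\ldots,x_n)$ (resp. $\mathbf y=(y_1,\ldots,y_n)$). Put $K=k(s_1,\ldots,s_n,t_1,\ldots,t_n)$, $L_{\mathbf s}=K(x_1,\ldots,x_n)$, $L_{\mathbf t}=K(y_1,\ldots,y_n)$, so $L_{\mathbf s}L_{\mathbf t}=k(\mathbf x,\mathbf y)$. Let $G_{\mathbf s,\mathbf t}=\mathrm{Gal}(k(\mathbf x,\mathbf y)/K)\cong\mathfrak S_n\times\mathfrak S_n$, which acts by permuting the $x_i$ and, independently, the $y_i$; the action is written on the right, $a\mapsto a^g$, with $a^{gh}=(a^g)^h$. Let $H\subset G_{\mathbf s,\mathbf t}$ be the diagonal subgroup of those $g$ for which there is $\pi\in\mathfrak S_n$ with $x_i^g=x_{\pi(i)}$ and $y_i^g=y_{\pi(i)}$ for all $i$. Define $u_0,\ldots,u_{n-1}\in k(\mathbf x,\mathbf y)$ as the unique solution of the system $y_i=u_0+u_1x_i+\cdots+u_{n-1}x_i^{n-1}$ ($i=1,\ldots,n$),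 and $v_0,\ldots,v_{n-1}$ as the unique solution of $x_i=v_0+v_1y_i+\cdots+v_{n-1}y_i^{n-1}$ ($i=1,\ldots,n$). For a subgroup $U$, $(\cdot)^U$ denotes the fixed field. *)

theory Defs
  imports
    "HOL-Algebra.Algebraic_Closure_Type"
    "HOL-Algebra.Generated_Fields"
    "HOL-Algebra.Coset"
    "HOL-Computational_Algebra.Fraction_Field"
    "HOL-Library.Poly_Mapping"
    "HOL-Library.FuncSet"
    "HOL-Combinatorics.Permutations"
begin

text \<open>
  Multivariate polynomials over \<open>'k\<close> in countably many variables are finitely supported maps
  from monomials to \<open>'k\<close>. As the number \<open>n\<close> is a term and not a type, \<open>k(x, y)\<close> in \<open>2n\<close>
  variables is the subfield \<open>rat_fun_field n\<close> of the fraction field \<open>'k rat_fun\<close>. The variable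
  \<open>x\<^sub>i\<close> has index \<open>2i\<close> and \<open>y\<^sub>i\<close> has index \<open>2i + 1\<close>, for \<open>1 \<le> i \<le> n\<close>.
\<close>

type_synonym 'k rat_fun = "((nat \<Rightarrow>\<^sub>0 nat) \<Rightarrow>\<^sub>0 'k) fract"

abbreviation rat_fun_ring :: "'k::field rat_fun ring" where
  "rat_fun_ring \<equiv> ring_of_type_algebra"

definition const_rf :: "'k::field \<Rightarrow> 'k rat_fun" where
  "const_rf c = Fract (Poly_Mapping.single 0 c) 1"

definition indet :: "nat \<Rightarrow> 'k::field rat_fun" where
  "indet m = Fract (Poly_Mapping.single (Poly_Mapping.single m 1) 1) 1"

definition x_var :: "nat \<Rightarrow> 'k::field rat_fun" where
  "x_var i = indet (2 * i)"

definition y_var :: "nat \<Rightarrow> 'k::field rat_fun" where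
  "y_var i = indet (2 * i + 1)"

definition adjoin :: "'k::field rat_fun set \<Rightarrow> 'k rat_fun set \<Rightarrow> 'k rat_fun set" where
  "adjoin E S = generate_field rat_fun_ring (E \<union> S)"

definition rat_fun_field :: "nat \<Rightarrow> 'k::field rat_fun set" where
  "rat_fun_field n = adjoin (range const_rf) (x_var ` {1..n} \<union> y_var ` {1..n})"

definition elem_sym :: "nat \<Rightarrow> (nat \<Rightarrow> 'a::comm_ring_1) \<Rightarrow> nat \<Rightarrow> 'a" where
  "elem_sym n z i = (\<Sum>A | A \<subseteq> {1..n} \<and> card A = i. \<Prod>j\<in>A. z j)"

definition base_field :: "nat \<Rightarrow> 'k::field rat_fun set" where
  "base_field n = adjoin (range const_rf) (elem_sym n x_var ` {1..n} \<union> elem_sym n y_var ` {1..n})"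

definition L_s :: "nat \<Rightarrow> 'k::field rat_fun set" where
  "L_s n = adjoin (base_field n) (x_var ` {1..n})"

definition L_t :: "nat \<Rightarrow> 'k::field rat_fun set" where
  "L_t n = adjoin (base_field n) (y_var ` {1..n})"

text \<open>
  The Galois group acts on the right, \<open>a\<^sup>g = g a\<close>, so that the product \<open>gh\<close> satisfies
  \<open>a\<^sup>g\<^sup>h = h (g a)\<close>. Automorphisms of \<open>L\<close> are extensional functions: outside \<open>L\<close> they take the
  value \<open>undefined\<close>.
\<close>

definition galois_group ::
    "'k::field rat_fun set \<Rightarrow> 'k rat_fun set \<Rightarrow> ('k rat_fun \<Rightarrow> 'k rat_fun) monoid" where
  "galois_group L E =
     \<lparr>carrier = {g \<in> extensional L.
        g \<in> ring_iso (rat_fun_ring\<lparr>carrier := L\<rparr>) (rat_fun_ring\<lparr>carrier := L\<rparr>) \<and>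
        (\<forall>a\<in>E. g a = a)},
      monoid.mult = (\<lambda>g h. compose L h g),
      one = (\<lambda>a\<in>L. a)\<rparr>"

definition fixed_field ::
    "'k::field rat_fun set \<Rightarrow> ('k rat_fun \<Rightarrow> 'k rat_fun) set \<Rightarrow> 'k rat_fun set" where
  "fixed_field L U = {a \<in> L. \<forall>g\<in>U. g a = a}"

definition G_st :: "nat \<Rightarrow> ('k::field rat_fun \<Rightarrow> 'k rat_fun) monoid" where
  "G_st n = galois_group (rat_fun_field n) (base_field n)"

definition diag_subgroup :: "nat \<Rightarrow> ('k::field rat_fun \<Rightarrow> 'k rat_fun) set" where
  "diag_subgroup n = {g \<in> carrier (G_st n).
     \<exists>\<pi>. \<pi> permutes {1..n} \<and> (\<forall>i\<in>{1..n}. g (x_var i) = x_var (\<pi> i) \<and> g (y_var i) = y_var (\<pi> i))}"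

definition interp_coeffs ::
    "nat \<Rightarrow> (nat \<Rightarrow> 'k::field rat_fun) \<Rightarrow> (nat \<Rightarrow> 'k rat_fun) \<Rightarrow> nat \<Rightarrow> 'k rat_fun" where
  "interp_coeffs n a b = (THE c. c \<in> {..<n} \<rightarrow>\<^sub>E rat_fun_field n \<and>
     (\<forall>i\<in>{1..n}. b i = (\<Sum>j<n. c j * a i ^ j)))"

definition u_coeff :: "nat \<Rightarrow> nat \<Rightarrow> 'k::field rat_fun" where
  "u_coeff n = interp_coeffs n x_var y_var"

definition v_coeff :: "nat \<Rightarrow> nat \<Rightarrow> 'k::field rat_fun" where
  "v_coeff n = interp_coeffs n y_var x_var"

end

theory Submission
  imports Defs
begin

text \<open>
  Let \<open>w\<close> be an element of \<open>L = k(x, y)\<close> whose orbit \<open>W\<close> under \<open>G = S\<^sub>n \<times> S\<^sub>n\<close> has \<open>d\<close> elements. If every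
  permutation pair that fixes \<open>w\<close> also fixes \<open>a \<in> L\<close>, then \<open>g w \<mapsto> g a\<close> is a well defined function on
  \<open>W\<close>; its Lagrange interpolation polynomial is unique, hence has \<open>G\<close>-invariant coefficients, and so
  \<open>a = Q(w)\<close> with \<open>Q\<close> of degree less than \<open>d\<close> over \<open>L\<^sup>G\<close>. A nonzero polynomial over \<open>L\<^sup>G\<close> that vanishes at
  \<open>w\<close> vanishes on \<open>W\<close>, so \<open>1, w, \<dots>, w\<^sup>d\<^sup>-\<^sup>1\<close> is a basis of the field fixed by the stabilizer of \<open>w\<close>.

  To see \<open>L\<^sup>G = K\<close>, make the denominator of an invariant fraction invariant by multiplying it with its
  conjugates; this leaves an invariant element of \<open>K[x, y]\<close>. An element of \<open>R[x\<^sub>j]\<close>, where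
  \<open>R = K[x\<^sub>1, \<dots>, x\<^sub>j\<^sub>-\<^sub>1]\<close>, is the value at \<open>x\<^sub>j\<close> of a polynomial over \<open>R\<close> of degree at most \<open>n - j\<close>. If it is
  invariant, this polynomial takes the same value at \<open>x\<^sub>j, \<dots>, x\<^sub>n\<close>, so it is constant.

  It remains to see that only the diagonal pairs fix \<open>u\<^sub>i = c\<^sub>1 y\<^sub>1 + \<dots> + c\<^sub>n y\<^sub>n\<close>, where \<open>c\<^sub>j\<close> is the
  coefficient of \<open>X\<^sup>i\<close> in the \<open>j\<close>-th Lagrange basis polynomial at the nodes \<open>x\<^sub>1, \<dots>, x\<^sub>n\<close>. Otherwise two of
  the \<open>c\<^sub>j\<close> coincide, hence all of them do by symmetry. But \<open>c\<^sub>1 x\<^sub>1\<^sup>r + \<dots> + c\<^sub>n x\<^sub>n\<^sup>r\<close> is \<open>1\<close> for \<open>r = i\<close> and \<open>0\<close>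
  for every other \<open>r < n\<close>, which is impossible because the power sums for \<open>r = 1\<close> and \<open>r = 2\<close> are nonzero and
  \<open>2 < n\<close>. The \<open>v\<^sub>i\<close> are the images of the \<open>u\<^sub>i\<close> under the automorphism that exchanges \<open>x\<close> and \<open>y\<close>.
\<close>

section \<open>Subrings, subfields and polynomials over them\<close>

text \<open>Substructures are those of HOL-Algebra because \<open>adjoin\<close> and
  \<open>dimension\<close> live there; the closure lemmas that follow translate them into the type
  class operations in which the calculations are done.\<close>

abbreviation subring_of_type :: "'a::comm_ring_1 set \<Rightarrow> bool" where
  "subring_of_type S \<equiv> subring S ring_of_type_algebra"

abbreviation subfield_of_type :: "'a::field set \<Rightarrow> bool" where
  "subfield_of_type S \<equiv> subfield S ring_of_type_algebra"

lemma ring_of_type_algebra_simps [simp]: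
  "carrier ring_of_type_algebra = UNIV"
  "x \<otimes>\<^bsub>ring_of_type_algebra\<^esub> y = x * y"
  "x \<oplus>\<^bsub>ring_of_type_algebra\<^esub> y = x + y"
  "\<one>\<^bsub>ring_of_type_algebra\<^esub> = 1"
  "\<zero>\<^bsub>ring_of_type_algebra\<^esub> = 0"
  by (simp_all add: ring_of_type_algebra_def)

lemma a_inv_ring_of_type_algebra [simp]:
  fixes x :: "'a::comm_ring_1"
  shows "\<ominus>\<^bsub>ring_of_type_algebra\<^esub> x = - x"
proof -
  interpret cring "ring_of_type_algebra :: 'a ring" by (rule cring_from_type_algebra)
  show ?thesis by (rule minus_equality) auto
qed

lemma m_inv_ring_of_type_algebra:
  fixes x :: "'a::field"
  assumes "x \<noteq> 0"
  shows "inv\<^bsub>ring_of_type_algebra\<^esub> x = inverse x"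
proof -
  interpret field "ring_of_type_algebra :: 'a ring" by (rule field_from_type_algebra)
  show ?thesis by (rule comm_inv_char) (use assms in auto)
qed

lemma subring_of_typeI:
  fixes S :: "'a::comm_ring_1 set"
  assumes "1 \<in> S" "\<And>a. a \<in> S \<Longrightarrow> - a \<in> S" "\<And>a b. a \<in> S \<Longrightarrow> b \<in> S \<Longrightarrow> a + b \<in> S"
    "\<And>a b. a \<in> S \<Longrightarrow> b \<in> S \<Longrightarrow> a * b \<in> S"
  shows "subring_of_type S"
proof -
  interpret cring "ring_of_type_algebra :: 'a ring" by (rule cring_from_type_algebra)
  show ?thesis by (rule subringI) (use assms in auto)
qed

context
  fixes S :: "'a::comm_ring_1 set"
  assumes S: "subring_of_type S"
begin

lemma subring_of_type_closed:
  shows subring_zero: "0 \<in> S" and subring_one: "1 \<in> S"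
    and subring_uminus: "a \<in> S \<Longrightarrow> - a \<in> S"
    and subring_add: "a \<in> S \<Longrightarrow> b \<in> S \<Longrightarrow> a + b \<in> S"
    and subring_mult: "a \<in> S \<Longrightarrow> b \<in> S \<Longrightarrow> a * b \<in> S"
  using subringE(2-7)[OF S] by auto

lemma subring_diff: "a \<in> S \<Longrightarrow> b \<in> S \<Longrightarrow> a - b \<in> S"
  using subring_add[of a "- b"] subring_uminus[of b] by simp

lemma subring_sum: "(\<And>i. i \<in> A \<Longrightarrow> f i \<in> S) \<Longrightarrow> sum f A \<in> S"
  by (induction A rule: infinite_finite_induct) (auto intro: subring_zero subring_add)

lemma subring_prod: "(\<And>i. i \<in> A \<Longrightarrow> f i \<in> S) \<Longrightarrow> prod f A \<in> S"
  by (induction A rule: infinite_finite_induct) (auto intro: subring_one subring_mult)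

lemma subring_power: "a \<in> S \<Longrightarrow> a ^ m \<in> S"
  by (induction m) (auto intro: subring_one subring_mult)

end

lemma subfield_of_typeI:
  fixes S :: "'a::field set"
  assumes "subring_of_type S" "\<And>a. a \<in> S \<Longrightarrow> inverse a \<in> S"
  shows "subfield_of_type S"
proof -
  interpret field "ring_of_type_algebra :: 'a ring" by (rule field_from_type_algebra)
  show ?thesis by (rule subfieldI') (use assms in \<open>auto simp: m_inv_ring_of_type_algebra\<close>)
qed

lemma subfield_imp_subring: "subfield_of_type S \<Longrightarrow> subring_of_type S"
  by (rule subfieldE(1))

lemma subfield_inverse:
  fixes S :: "'a::field set"
  assumes "subfield_of_type S" "a \<in> S"
  shows "inverse a \<in> S"
proof (cases "a = 0")
  case True
  then show ?thesis using assms by simp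
next
  case False
  interpret field "ring_of_type_algebra :: 'a ring" by (rule field_from_type_algebra)
  show ?thesis
    using subfield_m_inv(1)[OF assms(1), of a] assms(2) False
    by (simp add: m_inv_ring_of_type_algebra)
qed

lemma subfield_divide:
  fixes S :: "'a::field set"
  assumes "subfield_of_type S" "a \<in> S" "b \<in> S"
  shows "a / b \<in> S"
  using subring_mult[OF subfield_imp_subring[OF assms(1)] assms(2) subfield_inverse[OF assms(1,3)]]
  by (simp add: field_simps)

section \<open>Polynomials with coefficients in a subring\<close>

definition poly_over :: "'a::comm_ring_1 set \<Rightarrow> 'a Polynomial.poly set" where
  "poly_over S = {p. \<forall>i. Polynomial.coeff p i \<in> S}"

lemma poly_over_coeff: "p \<in> poly_over S \<Longrightarrow> Polynomial.coeff p i \<in> S"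
  by (simp add: poly_over_def)

context
  fixes S :: "'a::comm_ring_1 set"
  assumes S: "subring_of_type S"
begin

lemma poly_over_pCons_iff: "pCons c p \<in> poly_over S \<longleftrightarrow> c \<in> S \<and> p \<in> poly_over S"
  by (auto simp: poly_over_def coeff_pCons split: nat.splits)

lemma subring_poly_over: "subring_of_type (poly_over S)"
proof (rule subring_of_typeI)
  show "1 \<in> poly_over S"
    using S by (auto simp: poly_over_def coeff_1 intro: subring_of_type_closed)
qed (use S in \<open>auto simp: poly_over_def coeff_mult intro!: subring_of_type_closed subring_sum\<close>)

lemma poly_over_smult: "c \<in> S \<Longrightarrow> p \<in> poly_over S \<Longrightarrow> smult c p \<in> poly_over S"
  using S by (auto simp: poly_over_def intro: subring_of_type_closed)

lemma poly_over_monom: "c \<in> S \<Longrightarrow> Polynomial.monom c m \<in> poly_over S"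
  using S by (auto simp: poly_over_def intro: subring_of_type_closed)

lemma poly_over_poly: "p \<in> poly_over S \<Longrightarrow> a \<in> S \<Longrightarrow> poly p a \<in> S"
  using S by (auto simp: poly_altdef poly_over_def intro!: subring_sum subring_of_type_closed subring_power)

lemma poly_over_linear: "c \<in> S \<Longrightarrow> [:- c, 1:] \<in> poly_over S"
  using S subring_one[OF subring_poly_over]
  by (auto simp: poly_over_pCons_iff one_pCons intro: subring_of_type_closed)

text \<open>Horner's scheme: the coefficients of the quotient by X - c are values at c of tails of
  \<open>p\<close>.\<close>

lemma poly_over_synthetic_div: "p \<in> poly_over S \<Longrightarrow> c \<in> S \<Longrightarrow> synthetic_div p c \<in> poly_over S"
proof (induction p)
  case 0
  then show ?case using S by (simp add: poly_over_def subring_of_type_closed)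
next
  case (pCons a p)
  then show ?case by (auto simp: poly_over_pCons_iff poly_over_poly)
qed

text \<open>Division with remainder by a monic polynomial needs no inverses, so it works over a
  subring; only the value at the root \<open>w\<close> has to be kept. The induction adds one
  coefficient of \<open>Q\<close> at a time: X P + a has degree at most that of \<open>f\<close>,
  and subtracting one multiple of \<open>f\<close> brings it below.\<close>

lemma monic_reduction:
  assumes f: "f \<in> poly_over S" "lead_coeff f = 1" "Polynomial.degree f > 0" "poly f w = 0"
    and Q: "Q \<in> poly_over S"
  obtains P where "P \<in> poly_over S" "Polynomial.degree P < Polynomial.degree f"
    "poly P w = poly Q w"
  using Q
proof (induction Q arbitrary: thesis)
  case 0
  show ?case by (rule 0(1)[of 0]) (use f S in \<open>auto simp: poly_over_def intro: subring_of_type_closed\<close>)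
next
  case (pCons a Q)
  from pCons.prems(2) have a: "a \<in> S" and Q: "Q \<in> poly_over S"
    by (auto simp: poly_over_pCons_iff)
  obtain P where P: "P \<in> poly_over S" "Polynomial.degree P < Polynomial.degree f" "poly P w = poly Q w"
    using pCons.IH[OF _ Q] by blast
  define R where "R = pCons a P"
  define d where "d = Polynomial.degree f"
  define c where "c = Polynomial.coeff R d"
  have R: "R \<in> poly_over S" using a P by (simp add: R_def poly_over_pCons_iff)
  have dR: "Polynomial.degree R \<le> d"
    using P(2) by (simp add: R_def d_def degree_pCons_eq_if)
  define P' where "P' = R - smult c f"
  show ?case
  proof (rule pCons.prems(1))
    show "P' \<in> poly_over S"
      unfolding P'_def
      by (intro subring_diff[OF subring_poly_over] R poly_over_smult f) (use R in \<open>simp add: c_def poly_over_def\<close>)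
    show "Polynomial.degree P' < Polynomial.degree f"
    proof -
      have "Polynomial.coeff P' i = 0" if "i \<ge> d" for i
        using that dR f(2) unfolding P'_def c_def d_def
        by (cases "i = Polynomial.degree f") (auto simp: coeff_eq_0)
      then have "Polynomial.degree P' \<le> d - 1"
        by (intro degree_le) auto
      then show ?thesis using f(3) by (simp add: d_def)
    qed
    show "poly P' w = poly (pCons a Q) w"
      using P(3) f(4) by (simp add: P'_def R_def)
  qed
qed

end

section \<open>Homomorphisms of rings and fields\<close>

locale ring_map =
  fixes \<phi> :: "'a::comm_ring_1 \<Rightarrow> 'b::comm_ring_1"
  assumes map_add: "\<phi> (a + b) = \<phi> a + \<phi> b"
    and map_mult: "\<phi> (a * b) = \<phi> a * \<phi> b"
    and map_one: "\<phi> 1 = 1"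
begin

lemma map_zero: "\<phi> 0 = 0"
  using map_add[of 0 0] by simp

lemma map_uminus: "\<phi> (- a) = - \<phi> a"
  using map_add[of a "- a"] by (simp add: map_zero eq_neg_iff_add_eq_0 add.commute)

lemma map_diff: "\<phi> (a - b) = \<phi> a - \<phi> b"
  using map_add[of a "- b"] by (simp add: map_uminus)

lemma map_sum: "\<phi> (sum f A) = (\<Sum>i\<in>A. \<phi> (f i))"
  by (induction A rule: infinite_finite_induct) (auto simp: map_zero map_add)

lemma map_prod: "\<phi> (prod f A) = (\<Prod>i\<in>A. \<phi> (f i))"
  by (induction A rule: infinite_finite_induct) (auto simp: map_one map_mult)

lemma map_power: "\<phi> (a ^ m) = \<phi> a ^ m"
  by (induction m) (auto simp: map_one map_mult)

lemma poly_map_poly: "poly (map_poly \<phi> p) (\<phi> a) = \<phi> (poly p a)"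
  by (induction p) (auto simp: map_poly_pCons map_zero map_add map_mult)

lemma subring_vimage: "subring_of_type S \<Longrightarrow> subring_of_type (\<phi> -` S)"
  by (rule subring_of_typeI)
    (auto simp: map_add map_mult map_one map_uminus intro: subring_of_type_closed)

end

locale field_map = ring_map \<phi> for \<phi> :: "'a::field \<Rightarrow> 'b::field"
begin

lemma map_eq_0_iff: "\<phi> a = 0 \<longleftrightarrow> a = 0"
proof
  assume *: "\<phi> a = 0"
  show "a = 0"
  proof (rule ccontr)
    assume "a \<noteq> 0"
    then have "\<phi> (a * inverse a) = 1" by (simp add: map_one)
    then show False using * by (simp add: map_mult)
  qed
qed (simp add: map_zero)

lemma inj_map: "inj \<phi>"
  by (rule injI) (metis map_diff map_eq_0_iff eq_iff_diff_eq_0)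

lemma map_inverse: "\<phi> (inverse a) = inverse (\<phi> a)"
proof (cases "a = 0")
  case False
  then have "\<phi> a * \<phi> (inverse a) = 1" by (simp add: map_one flip: map_mult)
  then show ?thesis by (metis inverse_unique)
qed (simp add: map_zero)

lemma degree_map_poly': "Polynomial.degree (map_poly \<phi> p) = Polynomial.degree p"
  by (rule degree_map_poly) (simp add: map_eq_0_iff)

lemma subfield_vimage: "subfield_of_type S \<Longrightarrow> subfield_of_type (\<phi> -` S)"
  by (intro subfield_of_typeI subring_vimage)
    (auto simp: map_inverse intro: subfield_inverse subfield_imp_subring)

end

text \<open>Used with the identity for \<open>\<psi>\<close>: a homomorphism that fixes the
  generators of a field then fixes the whole field.\<close>

lemma subfield_fixed_points:
  fixes \<phi> \<psi> :: "'a::field \<Rightarrow> 'b::field"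
  assumes "field_map \<phi>" "field_map \<psi>"
  shows "subfield_of_type {a. \<phi> a = \<psi> a}"
proof -
  interpret f: field_map \<phi> by fact
  interpret g: field_map \<psi> by fact
  show ?thesis
    by (intro subfield_of_typeI subring_of_typeI)
      (auto simp: f.map_add g.map_add f.map_mult g.map_mult f.map_one g.map_one
        f.map_uminus g.map_uminus f.map_inverse g.map_inverse)
qed

section \<open>Invariants of iterated polynomial rings\<close>

text \<open>This is the ring T[z_1, ..., z_j], presented as a chain of extensions by one element so
  that the last generator can be split off. The numbering of the generators starts at 1.\<close>

primrec tower :: "'a::comm_ring_1 set \<Rightarrow> (nat \<Rightarrow> 'a) \<Rightarrow> nat \<Rightarrow> 'a set" where
  "tower T z 0 = T"
| "tower T z (Suc j) = (\<lambda>Q. poly Q (z (Suc j))) ` poly_over (tower T z j)"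

context
  fixes T :: "'a::comm_ring_1 set"
  assumes T: "subring_of_type T"
begin

lemma subring_tower: "subring_of_type (tower T z j)"
proof (induction j)
  case (Suc j)
  note PO = subring_of_type_closed[OF subring_poly_over[OF Suc]]
  show ?case
  proof (rule subring_of_typeI)
    show "1 \<in> tower T z (Suc j)"
      using image_eqI[of 1 "\<lambda>Q. poly Q (z (Suc j))" 1] PO(2) by simp
  qed (auto simp flip: poly_minus poly_add poly_mult intro: PO)
qed (simp add: T)

lemma tower_step_subset: "tower T z j \<subseteq> tower T z (Suc j)"
proof
  fix a assume "a \<in> tower T z j"
  then have "[:a:] \<in> poly_over (tower T z j)"
    using poly_over_monom[OF subring_tower, of a z j 0] by (simp add: monom_0)
  then show "a \<in> tower T z (Suc j)"
    by (auto intro!: image_eqI[of a _ "[:a:]"])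
qed

lemma tower_mono: "i \<le> j \<Longrightarrow> tower T z i \<subseteq> tower T z j"
  using tower_step_subset by (rule lift_Suc_mono_le)

lemma base_subset_tower: "T \<subseteq> tower T z j"
  using tower_mono[of 0 j z] by simp

lemma tower_contains: "1 \<le> i \<Longrightarrow> i \<le> j \<Longrightarrow> z i \<in> tower T z j"
proof -
  assume i: "1 \<le> i" "i \<le> j"
  then obtain i' where i': "i = Suc i'" by (cases i) auto
  have "Polynomial.monom 1 1 \<in> poly_over (tower T z i')"
    by (intro poly_over_monom subring_tower subring_one)
  then have "z i \<in> tower T z i"
    unfolding i' by (auto simp: poly_monom intro!: image_eqI[of _ _ "Polynomial.monom 1 1"])
  then show ?thesis using tower_mono[OF i(2)] by blast
qed

lemma tower_least:
  assumes "subring_of_type S" "T \<subseteq> S" "\<And>i. 1 \<le> i \<Longrightarrow> i \<le> j \<Longrightarrow> z i \<in> S"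
  shows "tower T z j \<subseteq> S"
  using assms(3)
proof (induction j)
  case (Suc j)
  then have *: "tower T z j \<subseteq> S" by simp
  have "poly Q (z (Suc j)) \<in> S" if "Q \<in> poly_over (tower T z j)" for Q
    using that * Suc.prems by (intro poly_over_poly assms(1)) (auto simp: poly_over_def)
  then show ?case by auto
qed (simp add: assms)

end

text \<open>The last generator is removed repeatedly, going from T[z_1, ..., z_j] to
  T[z_1, ..., z_{j-1}]. For each step the hypothesis \<open>hom\<close> supplies maps that fix the
  smaller ring and \<open>a\<close> and send z_j to any later z_m; what they do to the remaining
  generators is left open, so transpositions will serve.\<close>

lemma invariant_in_tower_base:
  fixes z :: "nat \<Rightarrow> 'a::field"
  assumes T: "subring_of_type T" and inj: "inj_on z {1..n}"
    and f: "(\<Prod>i\<in>{1..n}. [:- z i, 1:]) \<in> poly_over T"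
    and a: "a \<in> tower T z n"
    and hom: "\<And>j m. 1 \<le> j \<Longrightarrow> j < m \<Longrightarrow> m \<le> n \<Longrightarrow>
      \<exists>\<phi>. ring_map \<phi> \<and> (\<forall>t\<in>T. \<phi> t = t) \<and> (\<forall>i. 1 \<le> i \<and> i < j \<longrightarrow> \<phi> (z i) = z i) \<and>
        \<phi> (z j) = z m \<and> \<phi> a = a"
  shows "a \<in> T"
proof -
  \<comment> \<open>\<open>F j\<close> keeps the roots z_{j+1}, ..., z_n. Its coefficients lie in
    T[z_1, ..., z_j], since it arises from the full product by exact division by X - z_1, ..., X -
    z_j.\<close>
  define F where "F j = (\<Prod>i\<in>{Suc j..n}. [:- z i, 1:])" for j
  have Fstep: "F j = [:- z (Suc j), 1:] * F (Suc j)" if "j < n" for j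
  proof -
    have "{Suc j..n} = insert (Suc j) {Suc (Suc j)..n}" using that by auto
    then show ?thesis by (simp add: F_def)
  qed
  have F: "F j \<in> poly_over (tower T z j)" if "j \<le> n" for j
    using that
  proof (induction j)
    case 0
    then show ?case using f by (simp add: F_def)
  next
    case (Suc j)
    let ?c = "z (Suc j)"
    have "F j \<in> poly_over (tower T z (Suc j))"
      using Suc tower_step_subset[OF T, of z j] by (auto simp: poly_over_def)
    then have "synthetic_div (F j) ?c \<in> poly_over (tower T z (Suc j))"
      by (rule poly_over_synthetic_div[OF subring_tower[OF T]]) (rule tower_contains[OF T], auto)
    moreover have "synthetic_div (F j) ?c = F (Suc j)"
      by (rule synthetic_div_unique[of _ _ _ 0, THEN conjunct2, symmetric])
        (use Fstep[of j] Suc.prems in simp)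
    ultimately show ?case by simp
  qed
  have degF: "Polynomial.degree (F j) = n - j" for j
    unfolding F_def by (subst degree_prod_eq_sum_degree) auto
  have leadF: "lead_coeff (F j) = 1" for j
    unfolding F_def by (simp add: lead_coeff_prod)
  \<comment> \<open>The induction counts the generators removed so far, so \<open>j\<close> = n is
    the claim.\<close>
  have "a \<in> tower T z (n - j)" if "j \<le> n" for j
    using that
  proof (induction j)
    case 0
    then show ?case using a by simp
  next
    case (Suc j)
    define k where "k = n - Suc j"
    have k: "n - j = Suc k" "k < n" using Suc.prems by (auto simp: k_def)
    let ?R = "tower T z k"
    obtain Q0 where Q0: "Q0 \<in> poly_over ?R" "a = poly Q0 (z (Suc k))"
      using Suc by (auto simp: k)
    have "poly (F k) (z (Suc k)) = 0" using k(2) Fstep by simp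
    \<comment> \<open>Reduction modulo \<open>F k\<close>, of which z_{k+1} is a root, brings the
      degree below n - k.\<close>
    then obtain Q where Q: "Q \<in> poly_over ?R" "Polynomial.degree Q < n - k" "poly Q (z (Suc k)) = a"
      using monic_reduction[OF subring_tower[OF T] F leadF, of k "z (Suc k)" Q0] k(2) degF Q0
      by (metis less_imp_le zero_less_diff)
    \<comment> \<open>The map fixes \<open>a\<close> and the coefficients of \<open>Q\<close> and
      sends z_{k+1} to z_m, so \<open>Q\<close> takes the value \<open>a\<close> at all of z_{k+1},
      ..., z_n.\<close>
    have "poly Q (z m) = a" if m: "m \<in> {Suc k..n}" for m
    proof (cases "m = Suc k")
      case True
      then show ?thesis using Q by simp
    next
      case False
      then obtain \<phi> where \<phi>: "ring_map \<phi>" "\<forall>t\<in>T. \<phi> t = t"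
        "\<forall>i. 1 \<le> i \<and> i < Suc k \<longrightarrow> \<phi> (z i) = z i" "\<phi> (z (Suc k)) = z m" "\<phi> a = a"
        using hom[of "Suc k" m] m by auto
      interpret ring_map \<phi> by fact
      have "subring_of_type {t. \<phi> t = t}"
        by (rule subring_of_typeI) (auto simp: map_add map_mult map_one map_uminus)
      then have "?R \<subseteq> {t. \<phi> t = t}"
        by (rule tower_least[OF T]) (use \<phi> in auto)
      then have "map_poly \<phi> Q = Q"
        using Q(1) by (intro poly_eqI) (auto simp: coeff_map_poly map_zero poly_over_def)
      then show ?thesis using poly_map_poly[of Q "z (Suc k)"] \<phi> Q by simp
    qed
    \<comment> \<open>There are n - k distinct nodes and the degree is smaller, so \<open>Q\<close>
      is constant; its constant coefficient lies in the smaller ring.\<close>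
    then have "Q = [:a:]"
      using Q(2) k(2) inj
      by (intro poly_eqI_degree[of "z ` {Suc k..n}"])
         (auto simp: card_image inj_on_subset)
    then show ?case using Q(1) poly_over_coeff[of Q ?R 0] by (simp add: k_def)
  qed
  from this[of n] show ?thesis by simp
qed

section \<open>Lagrange interpolation\<close>

text \<open>The nodes form a set and not a list because they will be a Galois orbit or the set of
  all x_i.\<close>

definition lagrange_basis :: "'a::field set \<Rightarrow> 'a \<Rightarrow> 'a Polynomial.poly" where
  "lagrange_basis W w = (\<Prod>v\<in>W - {w}. smult (inverse (w - v)) [:- v, 1:])"

lemma lagrange_basis_poly:
  assumes "finite W" "w \<in> W" "v \<in> W"
  shows "poly (lagrange_basis W w) v = (if v = w then 1 else 0)"
proof (cases "v = w")
  case True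
  have "poly (smult (inverse (w - v)) [:- v, 1:]) w = 1" if "v \<in> W - {w}" for v
    using that by (auto simp: field_simps)
  then show ?thesis using True by (simp add: lagrange_basis_def poly_prod)
next
  case False
  then have "poly (lagrange_basis W w) v = 0"
    unfolding lagrange_basis_def poly_prod by (rule_tac prod_zero) (use assms in auto)
  then show ?thesis using False by simp
qed

lemma lagrange_basis_degree:
  assumes "finite W" "w \<in> W"
  shows "Polynomial.degree (lagrange_basis W w) < card W"
proof -
  have "Polynomial.degree (lagrange_basis W w) \<le>
      sum (Polynomial.degree \<circ> (\<lambda>v. smult (inverse (w - v)) [:- v, 1:])) (W - {w})"
    unfolding lagrange_basis_def using assms by (intro degree_prod_sum_le) auto
  also have "\<dots> \<le> (\<Sum>v\<in>W - {w}. 1)" by (rule sum_mono) (auto simp: o_def)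
  also have "\<dots> < card W" using assms by (auto simp: card_Diff_subset intro!: diff_less card_gt_0_iff[THEN iffD2])
  finally show ?thesis .
qed

lemma lagrange_basis_over:
  assumes "subfield_of_type S" "W \<subseteq> S" "w \<in> S"
  shows "lagrange_basis W w \<in> poly_over S"
proof -
  note S = subfield_imp_subring[OF assms(1)]
  show ?thesis unfolding lagrange_basis_def
    by (intro subring_prod[OF subring_poly_over[OF S]] poly_over_smult[OF S] poly_over_linear[OF S]
      subfield_inverse[OF assms(1)] subring_diff[OF S]) (use assms in auto)
qed

definition lagrange :: "'a::field set \<Rightarrow> ('a \<Rightarrow> 'a) \<Rightarrow> 'a Polynomial.poly" where
  "lagrange W h = (\<Sum>w\<in>W. smult (h w) (lagrange_basis W w))"

lemma lagrange_poly: "finite W \<Longrightarrow> v \<in> W \<Longrightarrow> poly (lagrange W h) v = h v"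
  by (simp add: lagrange_def poly_sum lagrange_basis_poly if_distrib cong: if_cong)

lemma lagrange_degree:
  assumes "finite W" "W \<noteq> {}"
  shows "Polynomial.degree (lagrange W h) < card W"
proof -
  have c: "card W > 0" using assms by (simp add: card_gt_0_iff)
  have "Polynomial.degree (smult (h w) (lagrange_basis W w)) \<le> card W - 1" if "w \<in> W" for w
    using lagrange_basis_degree[OF assms(1) that] degree_smult_le[of "h w" "lagrange_basis W w"] by linarith
  then have "Polynomial.degree (lagrange W h) \<le> card W - 1"
    unfolding lagrange_def by (rule degree_sum_le[OF assms(1)])
  then show ?thesis using c by simp
qed

lemma lagrange_over:
  assumes "subfield_of_type S" "W \<subseteq> S" "\<And>w. w \<in> W \<Longrightarrow> h w \<in> S"
  shows "lagrange W h \<in> poly_over S"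
proof -
  note S = subfield_imp_subring[OF assms(1)]
  show ?thesis unfolding lagrange_def
    by (intro subring_sum[OF subring_poly_over[OF S]] poly_over_smult[OF S] lagrange_basis_over)
     (use assms in auto)
qed

text \<open>Vieta's formulas: on multiplying out, the factors in a subset A contribute their
  constant terms and the others X; the subsets of size i together give (-1)^i e_i X^(n-i).\<close>

lemma prod_linear_over:
  fixes z :: "nat \<Rightarrow> 'a::comm_ring_1"
  assumes S: "subring_of_type S" and z: "\<And>i. i \<in> {1..n} \<Longrightarrow> elem_sym n z i \<in> S"
  shows "(\<Prod>i\<in>{1..n}. [:- z i, 1:]) \<in> poly_over S"
proof -
  note PO = subring_poly_over[OF S]
  let ?X = "[:0, 1:] :: 'a Polynomial.poly"
  \<comment> \<open>The hypothesis starts at i = 1; e_0 is the empty product 1.\<close>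
  have es: "elem_sym n z i \<in> S" if "i \<le> n" for i
  proof (cases "i = 0")
    case True
    have "{A. A \<subseteq> {1..n} \<and> card A = 0} = {{}}" by (auto simp: finite_subset)
    then show ?thesis using True subring_one[OF S] by (simp add: elem_sym_def)
  qed (use z that in auto)
  have pc: "(\<Prod>x\<in>A. [:- z x:]) = [:(-1) ^ card A * (\<Prod>x\<in>A. z x):]" for A
    by (induction A rule: infinite_finite_induct) (auto simp: one_pCons)
  have "(\<Prod>i\<in>{1..n}. [:- z i, 1:]) = (\<Prod>i\<in>{1..n}. [:- z i:] + ?X)" by simp
  also have "\<dots> = (\<Sum>A\<in>Pow {1..n}. (\<Prod>x\<in>A. [:- z x:]) * (\<Prod>x\<in>{1..n} - A. ?X))"
    by (rule prod_add) simp
  also have "\<dots> = (\<Sum>A\<in>Pow {1..n}. [:(-1) ^ card A * (\<Prod>x\<in>A. z x):] * ?X ^ (n - card A))"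
    by (rule sum.cong) (auto simp: pc card_Diff_subset finite_subset)
  also have "\<dots> = (\<Sum>i\<in>{..n}. \<Sum>A\<in>{A \<in> Pow {1..n}. card A = i}.
       [:(-1) ^ card A * (\<Prod>x\<in>A. z x):] * ?X ^ (n - card A))"
    by (rule sum.group[symmetric]) (auto dest!: card_mono[of "{Suc 0..n}", rotated])
  also have "\<dots> = (\<Sum>i\<in>{..n}. [:(-1) ^ i * elem_sym n z i:] * ?X ^ (n - i))"
  proof (rule sum.cong[OF refl])
    fix i
    have "(\<Sum>A\<in>{A \<in> Pow {1..n}. card A = i}. [:(-1) ^ card A * (\<Prod>x\<in>A. z x):] * ?X ^ (n - card A))
       = (\<Sum>A\<in>{A \<in> Pow {1..n}. card A = i}. [:(-1) ^ i * (\<Prod>x\<in>A. z x):]) * ?X ^ (n - i)"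
      unfolding sum_distrib_right by (rule sum.cong) auto
    also have "(\<Sum>A\<in>{A \<in> Pow {1..n}. card A = i}. [:(-1) ^ i * (\<Prod>x\<in>A. z x):])
       = [:\<Sum>A\<in>{A \<in> Pow {1..n}. card A = i}. (-1) ^ i * (\<Prod>x\<in>A. z x):]"
      by (rule poly_eqI) (simp add: coeff_sum coeff_pCons split: nat.splits)
    finally show "(\<Sum>A\<in>{A \<in> Pow {1..n}. card A = i}. [:(-1) ^ card A * (\<Prod>x\<in>A. z x):] * ?X ^ (n - card A))
       = [:(-1) ^ i * elem_sym n z i:] * ?X ^ (n - i)"
      by (simp add: elem_sym_def sum_distrib_left)
  qed
  also have "\<dots> \<in> poly_over S"
  proof (intro subring_sum[OF PO] subring_mult[OF PO] subring_power[OF PO])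
    fix i assume "i \<in> {..n}"
    then have "(-1) ^ i * elem_sym n z i \<in> S"
      by (intro subring_mult[OF S] subring_power[OF S] subring_uminus[OF S] subring_one[OF S] es) auto
    then show "[:(-1) ^ i * elem_sym n z i:] \<in> poly_over S"
      using poly_over_monom[OF S, of _ 0] by (simp add: monom_0)
    show "?X \<in> poly_over S" using poly_over_linear[OF S subring_zero[OF S]] by simp
  qed
  finally show ?thesis .
qed

section \<open>Automorphisms that permute the variables\<close>

text \<open>The notation \<open>inv\<close> is taken by HOL-Algebra.\<close>

abbreviation inv_fun :: "('a \<Rightarrow> 'b) \<Rightarrow> 'b \<Rightarrow> 'a" where
  "inv_fun f \<equiv> inv_into UNIV f"

text \<open>The map induced on fraction fields. All representations of \<open>q\<close> as a
  fraction compete in the description; they agree when \<open>h\<close> is an injective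
  homomorphism, because denominators then stay nonzero.\<close>

definition map_fract :: "('a::idom \<Rightarrow> 'b::idom) \<Rightarrow> 'a fract \<Rightarrow> 'b fract" where
  "map_fract h q = (THE r. \<exists>a b. b \<noteq> 0 \<and> q = Fract a b \<and> r = Fract (h a) (h b))"

lemma map_fract_Fract:
  assumes "ring_map h" "inj h" "b \<noteq> 0"
  shows "map_fract h (Fract a b) = Fract (h a) (h b)"
proof -
  interpret ring_map h by fact
  have nz: "h c \<noteq> 0" if "c \<noteq> 0" for c
    using that injD[OF assms(2), of c 0] by (auto simp: map_zero)
  have "Fract (h a') (h b') = Fract (h a) (h b)" if "b' \<noteq> 0" "Fract a b = Fract a' b'" for a' b'
    using that assms(3) by (auto simp: eq_fract nz simp flip: map_mult)
  then show ?thesis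
    unfolding map_fract_def using assms(3) by (intro the_equality) blast+
qed

lemma field_map_map_fract:
  assumes "ring_map h" "inj h"
  shows "field_map (map_fract h)"
proof -
  interpret ring_map h by fact
  note [simp] = map_fract_Fract[OF assms]
  have nz [simp]: "h c \<noteq> 0" if "c \<noteq> 0" for c
    using that injD[OF assms(2), of c 0] by (auto simp: map_zero)
  show ?thesis
  proof
    fix p q
    show "map_fract h (p + q) = map_fract h p + map_fract h q"
      by (cases p; cases q) (simp add: map_add map_mult)
    show "map_fract h (p * q) = map_fract h p * map_fract h q"
      by (cases p; cases q) (simp add: map_mult)
    show "map_fract h 1 = 1"
      by (simp add: One_fract_def map_one)
  qed
qed

text \<open>Multiplication is bilinear and every element is a sum of monomials, so it suffices to
  treat two monomials, where additivity of \<open>f\<close> on exponents enters. The two inductions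
  at the end extend this by linearity in \<open>q\<close> and then in \<open>p\<close>.\<close>

lemma map_key_mult:
  fixes f :: "'a::monoid_add \<Rightarrow> 'a" and p q :: "'a \<Rightarrow>\<^sub>0 'b::comm_ring_1"
  assumes "bij f" and add: "\<And>a b. f (a + b) = f a + f b"
  shows "Poly_Mapping.map_key f (p * q) = Poly_Mapping.map_key f p * Poly_Mapping.map_key f q"
proof -
  have inj: "inj f" and surj: "surj f" using assms(1) by (auto simp: bij_def)
  note plus = map_key_plus[OF inj] and zero = map_key_zero[OF inj]
  have upd: "Poly_Mapping.update a b r = Poly_Mapping.single a b + r"
    if "a \<notin> Poly_Mapping.keys r" for a b and r :: "'a \<Rightarrow>\<^sub>0 'b"
    using that by (intro poly_mapping_eqI) (auto simp: lookup_update lookup_add lookup_single when_def in_keys_iff)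
  have *: "Poly_Mapping.map_key f (Poly_Mapping.single a b * Poly_Mapping.single c d) =
    Poly_Mapping.map_key f (Poly_Mapping.single a b) * Poly_Mapping.map_key f (Poly_Mapping.single c d)"
    for a c :: 'a and b d :: 'b
  proof -
    obtain a' c' where "a = f a'" "c = f c'" using surj by (metis surjD)
    then show ?thesis by (simp add: mult_single map_key_single[OF inj] flip: add)
  qed
  have "Poly_Mapping.map_key f (Poly_Mapping.single a b * q) =
    Poly_Mapping.map_key f (Poly_Mapping.single a b) * Poly_Mapping.map_key f q" for a b
    by (induction q rule: update_induct) (simp_all add: zero upd plus distrib_left *)
  then show ?thesis
    by (induction p rule: update_induct) (simp_all add: zero upd plus distrib_right)
qed

text \<open>\<open>map_key\<close> acts contravariantly, by precomposition. Applied to the exponents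
  and then to the coefficients it becomes covariant: variable m goes to variable s m, and renaming
  along t and then along s is renaming along s \<circ> t.\<close>

definition rename_poly :: "(nat \<Rightarrow> nat) \<Rightarrow> ((nat \<Rightarrow>\<^sub>0 nat) \<Rightarrow>\<^sub>0 'k::field) \<Rightarrow> ((nat \<Rightarrow>\<^sub>0 nat) \<Rightarrow>\<^sub>0 'k)" where
  "rename_poly s = Poly_Mapping.map_key (Poly_Mapping.map_key s)"

definition rename :: "(nat \<Rightarrow> nat) \<Rightarrow> 'k::field rat_fun \<Rightarrow> 'k rat_fun" where
  "rename s = map_fract (rename_poly s)"

lemma bij_map_key:
  fixes s :: "'a \<Rightarrow> 'a"
  assumes "bij s"
  shows "bij (Poly_Mapping.map_key s :: ('a \<Rightarrow>\<^sub>0 'c::zero) \<Rightarrow> _)"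
proof (rule o_bij)
  have s: "inj s" "inj (inv_fun s)" "inv_fun s \<circ> s = (\<lambda>x. x)" "s \<circ> inv_fun s = (\<lambda>x. x)"
    using assms by (auto simp: bij_is_inj bij_imp_bij_inv fun_eq_iff bij_is_surj surj_f_inv_f)
  show "Poly_Mapping.map_key (inv_fun s) \<circ> Poly_Mapping.map_key s = (id :: ('a \<Rightarrow>\<^sub>0 'c) \<Rightarrow> _)"
    "Poly_Mapping.map_key s \<circ> Poly_Mapping.map_key (inv_fun s) = (id :: ('a \<Rightarrow>\<^sub>0 'c) \<Rightarrow> _)"
    by (simp_all only: fun_eq_iff o_apply map_key_compose[OF s(1,2)] map_key_compose[OF s(2,1)] s(3,4) map_key_id id_apply simp_thms)
qed

lemma inj_rename_poly: "bij s \<Longrightarrow> inj (rename_poly s)"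
  unfolding rename_poly_def by (intro bij_is_inj bij_map_key)

lemma ring_map_rename_poly:
  assumes "bij s"
  shows "ring_map (rename_poly s :: _ \<Rightarrow> (nat \<Rightarrow>\<^sub>0 nat) \<Rightarrow>\<^sub>0 'k::field)"
proof -
  note bij = bij_map_key[OF assms]
  note inj = bij_is_inj[OF bij]
  show ?thesis
  proof
    fix p q :: "(nat \<Rightarrow>\<^sub>0 nat) \<Rightarrow>\<^sub>0 'k"
    show "rename_poly s (p + q) = rename_poly s p + rename_poly s q"
      unfolding rename_poly_def by (rule map_key_plus[OF inj])
    show "rename_poly s (p * q) = rename_poly s p * rename_poly s q"
      unfolding rename_poly_def
      by (rule map_key_mult[OF bij]) (rule map_key_plus[OF bij_is_inj[OF assms]])
    have "Poly_Mapping.map_key s (0 :: nat \<Rightarrow>\<^sub>0 nat) = 0"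
      by (rule map_key_zero[OF bij_is_inj[OF assms]])
    then show "rename_poly s 1 = (1 :: (nat \<Rightarrow>\<^sub>0 nat) \<Rightarrow>\<^sub>0 'k)"
      unfolding rename_poly_def single_one[symmetric]
      using map_key_single[OF inj, of "0 :: nat \<Rightarrow>\<^sub>0 nat" "1 :: 'k"] by (simp only:)
  qed
qed

lemma rename_poly_compose:
  assumes "bij s" "bij t"
  shows "rename_poly s (rename_poly t p) = rename_poly (s \<circ> t) p"
proof -
  have "Poly_Mapping.map_key t \<circ> Poly_Mapping.map_key s =
      (Poly_Mapping.map_key (s \<circ> t) :: (nat \<Rightarrow>\<^sub>0 nat) \<Rightarrow> _)"
    using assms by (auto simp: fun_eq_iff map_key_compose bij_is_inj)
  then show ?thesis
    unfolding rename_poly_def using assms by (subst map_key_compose) (auto simp: bij_is_inj bij_map_key)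
qed

lemma field_map_rename: "bij s \<Longrightarrow> field_map (rename s)"
  unfolding rename_def by (intro field_map_map_fract ring_map_rename_poly inj_rename_poly)

lemma rename_compose:
  assumes "bij s" "bij t"
  shows "rename s (rename t a) = rename (s \<circ> t) a"
proof (cases a)
  case (Fract p q)
  have inj: "rename_poly t q \<noteq> 0"
    using Fract injD[OF inj_rename_poly[OF assms(2)], of q 0]
      ring_map.map_zero[OF ring_map_rename_poly[OF assms(2)]] by auto
  show ?thesis
    unfolding rename_def Fract using Fract inj assms
    by (simp add: map_fract_Fract ring_map_rename_poly inj_rename_poly bij_comp rename_poly_compose)
qed

lemma rename_id: "rename (\<lambda>x. x) a = a"
proof (cases a)
  case (Fract p q)
  have "rename_poly (\<lambda>x. x) r = r" for r :: "(nat \<Rightarrow>\<^sub>0 nat) \<Rightarrow>\<^sub>0 'a"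
  proof -
    have "Poly_Mapping.map_key (\<lambda>x. x) = (\<lambda>m :: nat \<Rightarrow>\<^sub>0 nat. m)"
      by (simp add: fun_eq_iff map_key_id)
    then show ?thesis by (simp add: rename_poly_def map_key_id)
  qed
  then show ?thesis
    unfolding rename_def Fract using Fract by (simp add: map_fract_Fract bij_id[unfolded id_def] ring_map_rename_poly inj_rename_poly)
qed

lemma rename_const:
  assumes "bij s"
  shows "rename s (const_rf c) = const_rf c"
proof -
  have "Poly_Mapping.map_key s (0 :: nat \<Rightarrow>\<^sub>0 nat) = 0"
    by (rule map_key_zero[OF bij_is_inj[OF assms]])
  then have "rename_poly s (Poly_Mapping.single 0 c) = Poly_Mapping.single 0 c"
    unfolding rename_poly_def
    using map_key_single[OF bij_is_inj[OF bij_map_key[OF assms]], of "0 :: nat \<Rightarrow>\<^sub>0 nat" c] by (simp only:)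
  then show ?thesis
    by (simp add: const_rf_def rename_def map_fract_Fract assms ring_map_rename_poly inj_rename_poly
      ring_map.map_one[OF ring_map_rename_poly])
qed

lemma rename_indet:
  assumes "bij s"
  shows "rename s (indet m) = indet (s m)"
proof -
  have "Poly_Mapping.map_key s (Poly_Mapping.single (s m) (1::nat)) = Poly_Mapping.single m 1"
    by (rule map_key_single[OF bij_is_inj[OF assms]])
  then have "rename_poly s (Poly_Mapping.single (Poly_Mapping.single m 1) c) =
      Poly_Mapping.single (Poly_Mapping.single (s m) 1) c" for c :: 'a
    unfolding rename_poly_def
    using map_key_single[OF bij_is_inj[OF bij_map_key[OF assms]], of "Poly_Mapping.single (s m) (1::nat)" c] by (simp only:)
  then show ?thesis
    by (simp add: indet_def rename_def map_fract_Fract assms ring_map_rename_poly inj_rename_poly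
      ring_map.map_one[OF ring_map_rename_poly])
qed

lemma indet_power:
  "indet m ^ r = Fract (Poly_Mapping.single (Poly_Mapping.single m r) 1) 1"
proof (induction r)
  case 0
  then show ?case by (simp add: One_fract_def)
next
  case (Suc r)
  then show ?case by (simp add: indet_def mult_single flip: single_add)
qed

lemma indet_power_eq_iff: "r > 0 \<Longrightarrow> (indet m :: 'k::field rat_fun) ^ r = indet l ^ r \<longleftrightarrow> m = l"
  unfolding indet_power
  by (auto simp: eq_fract dest!: arg_cong[where f = "\<lambda>p. Poly_Mapping.lookup p (Poly_Mapping.single m r)"]
    arg_cong[where f = "\<lambda>p. Poly_Mapping.lookup p m"] simp: lookup_single when_def split: if_splits)

lemma indet_eq_iff: "(indet m :: 'k::field rat_fun) = indet l \<longleftrightarrow> m = l"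
  using indet_power_eq_iff[of 1 m l] by simp

lemma x_var_eq_iff: "(x_var i :: 'k::field rat_fun) = x_var j \<longleftrightarrow> i = j"
  and y_var_eq_iff: "(y_var i :: 'k::field rat_fun) = y_var j \<longleftrightarrow> i = j"
  by (auto simp: x_var_def y_var_def indet_eq_iff)

section \<open>The action of pairs of permutations on x and y\<close>

definition rename_pair :: "(nat \<Rightarrow> nat) \<Rightarrow> (nat \<Rightarrow> nat) \<Rightarrow> nat \<Rightarrow> nat" where
  "rename_pair \<sigma> \<tau> m = (if even m then 2 * \<sigma> (m div 2) else 2 * \<tau> (m div 2) + 1)"

lemma rename_pair_compose: "rename_pair \<sigma> \<tau> \<circ> rename_pair \<sigma>' \<tau>' = rename_pair (\<sigma> \<circ> \<sigma>') (\<tau> \<circ> \<tau>')"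
  by (auto simp: rename_pair_def fun_eq_iff)

lemma rename_pair_id: "rename_pair (\<lambda>x. x) (\<lambda>x. x) = (\<lambda>x. x)"
  by (auto simp: rename_pair_def fun_eq_iff)

lemma bij_rename_pair:
  assumes "bij \<sigma>" "bij \<tau>"
  shows "bij (rename_pair \<sigma> \<tau>)"
proof (rule o_bij)
  show "rename_pair (inv_fun \<sigma>) (inv_fun \<tau>) \<circ> rename_pair \<sigma> \<tau> = id"
    "rename_pair \<sigma> \<tau> \<circ> rename_pair (inv_fun \<sigma>) (inv_fun \<tau>) = id"
    using assms unfolding rename_pair_compose
    by (auto simp: bij_is_inj bij_is_surj surj_iff[THEN iffD1] rename_pair_id[folded id_def])
qed

text \<open>A left action, whereas the product of \<open>G_st\<close> composes in the reverse order.
  It is defined on the whole type, so permutations may move variables to indices outside {1..n}; two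
  later arguments use a fresh variable of index n + 1.\<close>

definition perm_act :: "(nat \<Rightarrow> nat) \<Rightarrow> (nat \<Rightarrow> nat) \<Rightarrow> 'k::field rat_fun \<Rightarrow> 'k rat_fun" where
  "perm_act \<sigma> \<tau> = rename (rename_pair \<sigma> \<tau>)"

lemma field_map_perm_act: "bij \<sigma> \<Longrightarrow> bij \<tau> \<Longrightarrow> field_map (perm_act \<sigma> \<tau>)"
  unfolding perm_act_def by (intro field_map_rename bij_rename_pair)

lemma perm_act_compose:
  "bij \<sigma> \<Longrightarrow> bij \<tau> \<Longrightarrow> bij \<sigma>' \<Longrightarrow> bij \<tau>' \<Longrightarrow>
    perm_act \<sigma> \<tau> (perm_act \<sigma>' \<tau>' a) = perm_act (\<sigma> \<circ> \<sigma>') (\<tau> \<circ> \<tau>') a"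
  by (simp add: perm_act_def rename_compose bij_rename_pair rename_pair_compose)

lemma perm_act_id: "perm_act (\<lambda>x. x) (\<lambda>x. x) a = a"
  by (simp add: perm_act_def rename_pair_id rename_id)

lemma perm_act_inv:
  assumes "bij \<sigma>" "bij \<tau>"
  shows "perm_act (inv_fun \<sigma>) (inv_fun \<tau>) (perm_act \<sigma> \<tau> a) = a"
    "perm_act \<sigma> \<tau> (perm_act (inv_fun \<sigma>) (inv_fun \<tau>) a) = a"
proof -
  have "inv_fun \<sigma> \<circ> \<sigma> = (\<lambda>x. x)" "inv_fun \<tau> \<circ> \<tau> = (\<lambda>x. x)" "\<sigma> \<circ> inv_fun \<sigma> = (\<lambda>x. x)" "\<tau> \<circ> inv_fun \<tau> = (\<lambda>x. x)"
    using assms by (auto simp: fun_eq_iff bij_is_inj bij_is_surj surj_f_inv_f)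
  then show "perm_act (inv_fun \<sigma>) (inv_fun \<tau>) (perm_act \<sigma> \<tau> a) = a"
    "perm_act \<sigma> \<tau> (perm_act (inv_fun \<sigma>) (inv_fun \<tau>) a) = a"
    using assms by (simp_all add: perm_act_compose bij_imp_bij_inv perm_act_id)
qed

lemma perm_act_const: "bij \<sigma> \<Longrightarrow> bij \<tau> \<Longrightarrow> perm_act \<sigma> \<tau> (const_rf c) = const_rf c"
  by (simp add: perm_act_def rename_const bij_rename_pair)

lemma perm_act_x: "bij \<sigma> \<Longrightarrow> bij \<tau> \<Longrightarrow> perm_act \<sigma> \<tau> (x_var i) = x_var (\<sigma> i)"
  and perm_act_y: "bij \<sigma> \<Longrightarrow> bij \<tau> \<Longrightarrow> perm_act \<sigma> \<tau> (y_var i) = y_var (\<tau> i)"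
  by (simp_all add: perm_act_def x_var_def y_var_def rename_indet bij_rename_pair)
    (simp_all add: rename_pair_def)

section \<open>The field of invariants\<close>

context
  fixes E S :: "'k::field rat_fun set"
begin

interpretation field "rat_fun_ring :: 'k rat_fun ring"
  by (rule field_from_type_algebra)

lemma subfield_adjoin: "subfield_of_type (adjoin E S)"
  unfolding adjoin_def by (rule generate_field_is_subfield) simp

lemma adjoin_baseI: "a \<in> E \<Longrightarrow> a \<in> adjoin E S"
  and adjoin_genI: "a \<in> S \<Longrightarrow> a \<in> adjoin E S"
  unfolding adjoin_def by (auto intro: generate_field.incl)

lemma adjoin_least: "subfield_of_type F \<Longrightarrow> E \<subseteq> F \<Longrightarrow> S \<subseteq> F \<Longrightarrow> adjoin E S \<subseteq> F"
  unfolding adjoin_def by (rule generate_field_min_subfield1) auto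

end

lemma field_map_id: "field_map (\<lambda>a. a)"
  by unfold_locales auto

lemma map_elem_sym:
  assumes "ring_map \<phi>" "\<pi> permutes {1..n}" "\<And>j. j \<in> {1..n} \<Longrightarrow> \<phi> (z j) = z (\<pi> j)"
  shows "\<phi> (elem_sym n z i) = elem_sym n z i"
proof -
  interpret ring_map \<phi> by fact
  let ?X = "{A. A \<subseteq> {1..n} \<and> card A = i}"
  have inj: "inj_on \<pi> A" for A using permutes_inj_on[OF assms(2)] by blast
  have img: "\<pi> ` A \<subseteq> {1..n}" if "A \<subseteq> {1..n}" for A
    using that permutes_in_image[OF assms(2)] by auto
  have "\<phi> (elem_sym n z i) = (\<Sum>A\<in>?X. \<Prod>j\<in>A. z (\<pi> j))"
    unfolding elem_sym_def map_sum map_prod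
    by (intro sum.cong prod.cong refl) (use assms(3) in auto)
  also have "\<dots> = (\<Sum>A\<in>?X. \<Prod>j\<in>\<pi> ` A. z j)"
    by (intro sum.cong refl) (simp add: prod.reindex[OF inj])
  also have "\<dots> = (\<Sum>A\<in>?X. \<Prod>j\<in>A. z j)"
  proof (rule sum.reindex_bij_witness[of _ "\<lambda>A. inv_fun \<pi> ` A" "\<lambda>A. \<pi> ` A"])
    fix A assume "A \<in> ?X"
    then show "inv_fun \<pi> ` \<pi> ` A = A" "\<pi> ` inv_fun \<pi> ` A = A" "\<pi> ` A \<in> ?X"
      using img inj by (auto simp: image_comp permutes_inv_o[OF assms(2)] card_image)
    have p: "inv_fun \<pi> permutes {1..n}" using assms(2) by (rule permutes_inv)
    show "inv_fun \<pi> ` A \<in> ?X"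
      using \<open>A \<in> ?X\<close> permutes_in_image[OF p] by (auto simp: card_image permutes_inj_on[OF p])
  qed simp
  finally show ?thesis by (simp add: elem_sym_def)
qed

lemma rat_fun_field_gens:
  "const_rf c \<in> rat_fun_field n" "i \<in> {1..n} \<Longrightarrow> x_var i \<in> rat_fun_field n"
  "i \<in> {1..n} \<Longrightarrow> y_var i \<in> rat_fun_field n"
  by (auto simp: rat_fun_field_def intro: adjoin_baseI adjoin_genI)

context
  fixes n :: nat and \<sigma> \<tau> :: "nat \<Rightarrow> nat"
  assumes \<sigma>: "\<sigma> permutes {1..n}" and \<tau>: "\<tau> permutes {1..n}"
begin

lemma perm_act_base_field: "a \<in> base_field n \<Longrightarrow> perm_act \<sigma> \<tau> a = a"
proof -
  note bij = permutes_bij[OF \<sigma>] permutes_bij[OF \<tau>]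
  have fm: "field_map (perm_act \<sigma> \<tau> :: 'a rat_fun \<Rightarrow> _)" by (rule field_map_perm_act[OF bij])
  interpret field_map "perm_act \<sigma> \<tau> :: 'a rat_fun \<Rightarrow> _" by (rule fm)
  have "base_field n \<subseteq> {a :: 'a rat_fun. perm_act \<sigma> \<tau> a = a}"
    unfolding base_field_def
    using map_elem_sym[OF ring_map_axioms \<sigma>, of x_var] map_elem_sym[OF ring_map_axioms \<tau>, of y_var]
    by (intro adjoin_least subfield_fixed_points[OF fm field_map_id])
      (auto simp: perm_act_const bij perm_act_x perm_act_y)
  then show "a \<in> base_field n \<Longrightarrow> perm_act \<sigma> \<tau> a = a" by auto
qed

lemma perm_act_rat_fun_field: "a \<in> rat_fun_field n \<Longrightarrow> perm_act \<sigma> \<tau> a \<in> rat_fun_field n"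
proof -
  note bij = permutes_bij[OF \<sigma>] permutes_bij[OF \<tau>]
  interpret field_map "perm_act \<sigma> \<tau> :: 'a rat_fun \<Rightarrow> _" by (rule field_map_perm_act[OF bij])
  let ?L = "rat_fun_field n :: 'a rat_fun set"
  have "?L \<subseteq> perm_act \<sigma> \<tau> -` ?L"
    unfolding rat_fun_field_def[of n]
    by (intro adjoin_least subfield_vimage subfield_adjoin; fold rat_fun_field_def)
      (use permutes_in_image[OF \<sigma>] permutes_in_image[OF \<tau>]
        in \<open>auto simp: perm_act_const bij perm_act_x perm_act_y intro!: rat_fun_field_gens\<close>)
  then show "a \<in> rat_fun_field n \<Longrightarrow> perm_act \<sigma> \<tau> a \<in> rat_fun_field n" by auto
qed

end

lemma subfield_rat_fun_field: "subfield_of_type (rat_fun_field n)"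
  unfolding rat_fun_field_def by (rule subfield_adjoin)

lemma subfield_base_field: "subfield_of_type (base_field n)"
  unfolding base_field_def by (rule subfield_adjoin)

lemma elem_sym_closed:
  assumes "subring_of_type S" "\<And>j. j \<in> {1..n} \<Longrightarrow> z j \<in> S"
  shows "elem_sym n z i \<in> S"
  unfolding elem_sym_def by (intro subring_sum subring_prod assms) (use assms in auto)

lemma base_field_subset: "base_field n \<subseteq> rat_fun_field n"
  unfolding base_field_def
  by (rule adjoin_least[OF subfield_rat_fun_field])
    (auto intro!: rat_fun_field_gens elem_sym_closed subfield_imp_subring subfield_rat_fun_field)

lemma adjoin_L_s_L_t: "adjoin (L_s n) (L_t n) = rat_fun_field n"
proof
  have "L_s n \<subseteq> rat_fun_field n" "L_t n \<subseteq> rat_fun_field n"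
    unfolding L_s_def L_t_def
    by (intro adjoin_least subfield_rat_fun_field base_field_subset; auto simp: rat_fun_field_gens)+
  then show "adjoin (L_s n) (L_t n) \<subseteq> rat_fun_field n"
    by (intro adjoin_least subfield_rat_fun_field)
  show "rat_fun_field n \<subseteq> adjoin (L_s n) (L_t n)"
    unfolding rat_fun_field_def[of n]
    by (intro adjoin_least[OF subfield_adjoin])
      (auto simp: L_s_def L_t_def base_field_def intro: adjoin_baseI adjoin_genI)
qed

lemma subfield_fractions:
  fixes P :: "'a::field set"
  assumes P: "subring_of_type P"
  shows "subfield_of_type {p / q | p q. p \<in> P \<and> q \<in> P}" (is "subfield_of_type ?F")
proof (intro subfield_of_typeI subring_of_typeI)
  note closed = subring_of_type_closed[OF P]
  have I: "p / q \<in> ?F" if "p \<in> P" "q \<in> P" for p q using that by blast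
  show "1 \<in> ?F" using I[of 1 1] closed by simp
  show "- a \<in> ?F" if a: "a \<in> ?F" for a
  proof -
    from a obtain p q where "a = p / q" "p \<in> P" "q \<in> P" by blast
    then show ?thesis using I[of "- p" q] closed by simp
  qed
  show "inverse a \<in> ?F" if a: "a \<in> ?F" for a
  proof -
    from a obtain p q where "a = p / q" "p \<in> P" "q \<in> P" by blast
    then show ?thesis using I[of q p] by simp
  qed
  show "a * b \<in> ?F" if ab: "a \<in> ?F" "b \<in> ?F" for a b
  proof -
    from ab obtain p q r s where "a = p / q" "b = r / s" "p \<in> P" "q \<in> P" "r \<in> P" "s \<in> P" by blast
    then show ?thesis using I[of "p * r" "q * s"] closed by simp
  qed
  show "a + b \<in> ?F" if "a \<in> ?F" "b \<in> ?F" for a b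
  proof -
    from that obtain p q r s where *: "a = p / q" "b = r / s" "p \<in> P" "q \<in> P" "r \<in> P" "s \<in> P" by blast
    show ?thesis
    proof (cases "q = 0 \<or> s = 0")
      case True
      then have "a + b = a \<or> a + b = b" using * by auto
      then show ?thesis using that by (elim disjE) (simp_all only:)
    next
      case False
      then have "a + b = (p * s + r * q) / (q * s)" using * by (simp add: field_simps)
      then show ?thesis using I * closed by simp
    qed
  qed
qed

section \<open>The fixed field of all pairs of permutations\<close>

definition perm_pairs :: "nat \<Rightarrow> ((nat \<Rightarrow> nat) \<times> (nat \<Rightarrow> nat)) set" where
  "perm_pairs n = {\<pi>. \<pi> permutes {1..n}} \<times> {\<pi>. \<pi> permutes {1..n}}"

lemma finite_perm_pairs: "finite (perm_pairs n)"
  by (simp add: perm_pairs_def finite_permutations)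

text \<open>Left translation permutes the group, which makes orbits and products over the group
  invariant.\<close>

lemma perm_act_reindex:
  assumes \<sigma>: "\<sigma> permutes {1..n}" and \<tau>: "\<tau> permutes {1..n}"
  shows "(\<lambda>(\<alpha>, \<beta>). (\<sigma> \<circ> \<alpha>, \<tau> \<circ> \<beta>)) ` perm_pairs n = perm_pairs n"
    "inj_on (\<lambda>(\<alpha>, \<beta>). (\<sigma> \<circ> \<alpha>, \<tau> \<circ> \<beta>)) (perm_pairs n)"
proof -
  let ?f = "\<lambda>(\<alpha>, \<beta>). (\<sigma> \<circ> \<alpha>, \<tau> \<circ> \<beta>)"
  have "(\<alpha>, \<beta>) \<in> ?f ` perm_pairs n" if "(\<alpha>, \<beta>) \<in> perm_pairs n" for \<alpha> \<beta>
  proof (rule image_eqI[of _ _ "(inv_fun \<sigma> \<circ> \<alpha>, inv_fun \<tau> \<circ> \<beta>)"])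
    show "(\<alpha>, \<beta>) = ?f (inv_fun \<sigma> \<circ> \<alpha>, inv_fun \<tau> \<circ> \<beta>)"
      using \<sigma> \<tau> by (simp add: o_assoc permutes_inv_o)
    show "(inv_fun \<sigma> \<circ> \<alpha>, inv_fun \<tau> \<circ> \<beta>) \<in> perm_pairs n"
      using that \<sigma> \<tau> by (auto simp: perm_pairs_def intro: permutes_compose permutes_inv)
  qed
  moreover have "?f p \<in> perm_pairs n" if "p \<in> perm_pairs n" for p
    using that \<sigma> \<tau> by (auto simp: perm_pairs_def intro: permutes_compose)
  ultimately show "?f ` perm_pairs n = perm_pairs n" by auto
  have cancel: "\<alpha> = \<beta>" if "\<pi> permutes {1..n}" "\<pi> \<circ> \<alpha> = \<pi> \<circ> \<beta>" for \<pi> \<alpha> \<beta> :: "nat \<Rightarrow> nat"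
    using that(2) injD[OF permutes_inj[OF that(1)]] by (simp add: fun_eq_iff)
  show "inj_on ?f (perm_pairs n)"
    by (rule inj_onI) (auto dest: cancel[OF \<sigma>] cancel[OF \<tau>])
qed

text \<open>This is L^G = K for G = S_n \<times> S_n. Polynomials are taken over K instead of k:
  \<open>R\<close> is K[x] and \<open>P\<close> is K[x, y], so the monic polynomials with roots x_1,
  ..., x_n and y_1, ..., y_n have coefficients in the bottom ring from the start.\<close>

lemma invariant_in_base_field:
  fixes a :: "'k::field rat_fun"
  assumes a: "a \<in> rat_fun_field n"
    and inv: "\<And>\<sigma> \<tau>. \<sigma> permutes {1..n} \<Longrightarrow> \<tau> permutes {1..n} \<Longrightarrow> perm_act \<sigma> \<tau> a = a"
  shows "a \<in> base_field n"
proof -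
  define K where "K = (base_field n :: 'k rat_fun set)"
  have K: "subring_of_type K" unfolding K_def by (rule subfield_imp_subring[OF subfield_base_field])
  define R where "R = tower K x_var n"
  have R: "subring_of_type R" unfolding R_def by (rule subring_tower[OF K])
  define P where "P = tower R y_var n"
  have P: "subring_of_type P" unfolding P_def by (rule subring_tower[OF R])
  have KR: "K \<subseteq> R" unfolding R_def by (rule base_subset_tower[OF K])
  have RP: "R \<subseteq> P" unfolding P_def by (rule base_subset_tower[OF R])
  have xR: "x_var i \<in> R" and yP: "y_var i \<in> P" if "i \<in> {1..n}" for i
    using that tower_contains[OF K, of i n x_var] tower_contains[OF R, of i n y_var]
    by (auto simp: R_def P_def)
  have constK: "const_rf c \<in> K" for c
    unfolding K_def base_field_def by (auto intro: adjoin_baseI)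
  have esK: "elem_sym n x_var i \<in> K" "elem_sym n y_var i \<in> K" if "i \<in> {1..n}" for i
    unfolding K_def base_field_def by (rule adjoin_genI, use that in simp)+
  \<comment> \<open>An invariant of K[x, y] is first freed of the y_i over K[x] and then of the x_i
    over K.\<close>
  have invP: "b \<in> K" if b: "b \<in> P"
    "\<And>\<sigma> \<tau>. \<sigma> permutes {1..n} \<Longrightarrow> \<tau> permutes {1..n} \<Longrightarrow> perm_act \<sigma> \<tau> b = b" for b
  proof -
    have "b \<in> R"
    proof (rule invariant_in_tower_base[OF R, of y_var n])
      show "(\<Prod>i\<in>{1..n}. [:- y_var i, 1:]) \<in> poly_over R"
        by (rule prod_linear_over[OF R]) (use esK KR in auto)
      show "b \<in> tower R y_var n" using b by (simp add: P_def)
      fix j m assume jm: "1 \<le> j" "j < m" "m \<le> n"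
      let ?\<tau> = "transpose j m"
      have \<tau>: "?\<tau> permutes {1..n}" using jm by (intro permutes_swap_id) auto
      have id: "(\<lambda>i. i) permutes {1..n}" by (rule permutes_id[unfolded id_def])
      note bij = permutes_bij[OF id] permutes_bij[OF \<tau>]
      \<comment> \<open>It exchanges y_j and y_m and leaves all x_i alone, hence fixes K[x].\<close>
      let ?\<phi> = "perm_act (\<lambda>i. i) ?\<tau> :: 'k rat_fun \<Rightarrow> _"
      interpret field_map ?\<phi> by (rule field_map_perm_act[OF bij])
      have "R \<subseteq> {t. ?\<phi> t = t}" unfolding R_def
        by (intro tower_least[OF K] subfield_imp_subring subfield_fixed_points field_map_id field_map_axioms)
          (auto simp: K_def perm_act_base_field[OF id \<tau>] perm_act_x bij)
      then show "\<exists>\<phi>. ring_map \<phi> \<and> (\<forall>t\<in>R. \<phi> t = t) \<and> (\<forall>i. 1 \<le> i \<and> i < j \<longrightarrow> \<phi> (y_var i) = y_var i) \<and>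
        \<phi> (y_var j) = y_var m \<and> \<phi> b = b"
        using jm b(2)[OF id \<tau>]
        by (intro exI[of _ ?\<phi>]) (auto simp: ring_map_axioms perm_act_y bij)
    qed (auto simp: inj_on_def y_var_eq_iff)
    then show "b \<in> K"
      unfolding R_def
    proof (rule invariant_in_tower_base[OF K, rotated 2])
      show "(\<Prod>i\<in>{1..n}. [:- x_var i, 1:]) \<in> poly_over K"
        by (rule prod_linear_over[OF K]) (use esK in auto)
      fix j m assume jm: "1 \<le> j" "j < m" "m \<le> n"
      let ?\<sigma> = "transpose j m"
      have \<sigma>: "?\<sigma> permutes {1..n}" using jm by (intro permutes_swap_id) auto
      have id: "(\<lambda>i. i) permutes {1..n}" by (rule permutes_id[unfolded id_def])
      note bij = permutes_bij[OF \<sigma>] permutes_bij[OF id]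
      let ?\<phi> = "perm_act ?\<sigma> (\<lambda>i. i) :: 'k rat_fun \<Rightarrow> _"
      interpret field_map ?\<phi> by (rule field_map_perm_act[OF bij])
      show "\<exists>\<phi>. ring_map \<phi> \<and> (\<forall>t\<in>K. \<phi> t = t) \<and> (\<forall>i. 1 \<le> i \<and> i < j \<longrightarrow> \<phi> (x_var i) = x_var i) \<and>
        \<phi> (x_var j) = x_var m \<and> \<phi> b = b"
        using jm b(2)[OF \<sigma> id]
        by (intro exI[of _ ?\<phi>]) (auto simp: ring_map_axioms perm_act_x bij K_def perm_act_base_field[OF \<sigma> id])
    qed (auto simp: inj_on_def x_var_eq_iff)
  qed
  \<comment> \<open>Conjugates of elements of K[x, y] stay there, so the norm of a denominator does
    too.\<close>
  have actP: "perm_act \<sigma> \<tau> b \<in> P" if "\<sigma> permutes {1..n}" "\<tau> permutes {1..n}" "b \<in> P" for \<sigma> \<tau> b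
  proof -
    note bij = permutes_bij[OF that(1)] permutes_bij[OF that(2)]
    let ?\<phi> = "perm_act \<sigma> \<tau> :: 'k rat_fun \<Rightarrow> _"
    interpret field_map ?\<phi> by (rule field_map_perm_act[OF bij])
    have "R \<subseteq> ?\<phi> -` P" unfolding R_def
      by (intro tower_least[OF K] subring_vimage P)
        (use KR RP xR permutes_in_image[OF that(1)] in \<open>auto simp: K_def perm_act_base_field[OF that(1,2)] perm_act_x bij\<close>)
    then have "P \<subseteq> ?\<phi> -` P"
      unfolding P_def by (intro tower_least[OF R] subring_vimage P[unfolded P_def]; fold P_def)
        (use yP permutes_in_image[OF that(2)] in \<open>auto simp: perm_act_y bij\<close>)
    then show ?thesis using that by blast
  qed
  have "rat_fun_field n \<subseteq> {p / q | p q. p \<in> P \<and> q \<in> P}"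
    unfolding rat_fun_field_def
  proof (rule adjoin_least[OF subfield_fractions[OF P]])
    have PF: "P \<subseteq> {p / q | p q. p \<in> P \<and> q \<in> P}"
      using subring_one[OF P] by (intro subsetI CollectI exI[of _ 1] exI) auto
    have "range const_rf \<subseteq> P" using constK KR RP by auto
    then show "range const_rf \<subseteq> {p / q | p q. p \<in> P \<and> q \<in> P}"
      using PF by (rule order_trans)
    have "x_var ` {1..n} \<union> y_var ` {1..n} \<subseteq> P" using xR yP RP by auto
    then show "x_var ` {1..n} \<union> y_var ` {1..n} \<subseteq> {p / q | p q. p \<in> P \<and> q \<in> P}"
      using PF by (rule order_trans)
  qed
  then obtain p q where pq: "a = p / q" "p \<in> P" "q \<in> P" using a by blast
  show ?thesis
  proof (cases "q = 0")
    \<comment> \<open>Here a = p / 0 = 0 by convention.\<close>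
    case True
    then show ?thesis using pq subring_zero[OF K] by (simp add: K_def)
  next
    case False
    \<comment> \<open>The norm of the denominator is nonzero and invariant. Its factor for the
      identity pair is \<open>q\<close>, hence a N = p M with the cofactor M in K[x, y], and a = (a
      N) / N is a quotient of two invariants of K[x, y].\<close>
    define N where "N = (\<Prod>(\<sigma>, \<tau>)\<in>perm_pairs n. perm_act \<sigma> \<tau> q)"
    have id: "((\<lambda>i. i), (\<lambda>i. i)) \<in> perm_pairs n"
      by (simp add: perm_pairs_def permutes_id[unfolded id_def])
    have Nq: "N = q * (\<Prod>(\<sigma>, \<tau>)\<in>perm_pairs n - {((\<lambda>i. i), (\<lambda>i. i))}. perm_act \<sigma> \<tau> q)" (is "_ = q * ?M")
      unfolding N_def using prod.remove[OF finite_perm_pairs id, of "\<lambda>(\<sigma>, \<tau>). perm_act \<sigma> \<tau> q"]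
      by (simp add: perm_act_id)
    have MP: "?M \<in> P"
      by (rule subring_prod[OF P]) (auto simp: perm_pairs_def intro!: actP pq)
    have NP: "N \<in> P" unfolding Nq by (intro subring_mult[OF P] MP pq)
    have N0: "N \<noteq> 0"
      unfolding N_def using False finite_perm_pairs
      by (auto simp: perm_pairs_def permutes_bij field_map.map_eq_0_iff[OF field_map_perm_act])
    have Ninv: "perm_act \<sigma> \<tau> N = N" if st: "\<sigma> permutes {1..n}" "\<tau> permutes {1..n}" for \<sigma> \<tau>
    proof -
      note bij = permutes_bij[OF st(1)] permutes_bij[OF st(2)]
      let ?\<phi> = "perm_act \<sigma> \<tau> :: 'k rat_fun \<Rightarrow> _"
      interpret field_map ?\<phi> by (rule field_map_perm_act[OF bij])
      have "?\<phi> N = (\<Prod>p\<in>perm_pairs n. (\<lambda>(\<sigma>, \<tau>). perm_act \<sigma> \<tau> q) ((\<lambda>(\<alpha>, \<beta>). (\<sigma> \<circ> \<alpha>, \<tau> \<circ> \<beta>)) p))"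
        unfolding N_def map_prod
        by (rule prod.cong) (auto simp: perm_act_compose bij perm_pairs_def permutes_bij)
      also have "\<dots> = (\<Prod>p\<in>(\<lambda>(\<alpha>, \<beta>). (\<sigma> \<circ> \<alpha>, \<tau> \<circ> \<beta>)) ` perm_pairs n. (\<lambda>(\<sigma>, \<tau>). perm_act \<sigma> \<tau> q) p)"
        by (simp add: prod.reindex[OF perm_act_reindex(2)[OF st]])
      also have "\<dots> = N" unfolding perm_act_reindex(1)[OF st] N_def ..
      finally show ?thesis .
    qed
    have "a * N = p * ?M" unfolding Nq using pq False by simp
    then have "a * N \<in> P" using subring_mult[OF P pq(2) MP] by simp
    then have "a * N \<in> K"
    proof (rule invP)
      fix \<sigma> \<tau> assume st: "\<sigma> permutes {1..n}" "\<tau> permutes {1..n}"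
      show "perm_act \<sigma> \<tau> (a * N) = a * N"
        using inv[OF st] Ninv[OF st]
          ring_map.map_mult[OF field_map.axioms(1)[OF field_map_perm_act[OF permutes_bij[OF st(1)] permutes_bij[OF st(2)]]]]
        by metis
    qed
    then have "a * N / N \<in> K"
      using invP[OF NP Ninv] subfield_divide[OF subfield_base_field] unfolding K_def by blast
    then show ?thesis using N0 by (simp add: K_def)
  qed
qed

section \<open>The Galois group\<close>

context
  fixes g :: "'k::field rat_fun \<Rightarrow> 'k rat_fun" and n :: nat
  assumes g: "g \<in> carrier (G_st n)"
begin

lemma G_st_add: "a \<in> rat_fun_field n \<Longrightarrow> b \<in> rat_fun_field n \<Longrightarrow> g (a + b) = g a + g b"
  and G_st_mult: "a \<in> rat_fun_field n \<Longrightarrow> b \<in> rat_fun_field n \<Longrightarrow> g (a * b) = g a * g b"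
  and G_st_one: "g 1 = 1"
  and G_st_inj: "inj_on g (rat_fun_field n)"
  and G_st_base: "a \<in> base_field n \<Longrightarrow> g a = a"
  using g by (auto simp: G_st_def galois_group_def ring_iso_def ring_hom_def bij_betw_def Pi_iff)

lemma G_st_poly:
  assumes "f \<in> poly_over (base_field n)" "a \<in> rat_fun_field n"
  shows "g (poly f a) = poly f (g a)"
proof -
  note K = subfield_imp_subring[OF subfield_base_field] and L = subfield_imp_subring[OF subfield_rat_fun_field]
  \<comment> \<open>Membership in L is carried along because \<open>g\<close> respects sums and
    products only there.\<close>
  have "g (poly f a) = poly f (g a) \<and> poly f a \<in> rat_fun_field n"
    using assms(1)
  proof (induction f)
    case 0
    then show ?case by (simp add: G_st_base subring_zero[OF K] subring_zero[OF L])
  next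
    case (pCons c f)
    then have c: "c \<in> base_field n" and IH: "g (poly f a) = poly f (g a)" "poly f a \<in> rat_fun_field n"
      by (auto simp: poly_over_pCons_iff[OF K])
    have "c \<in> rat_fun_field n" using c base_field_subset by blast
    then show ?case
      using c IH assms(2) by (simp add: G_st_base G_st_add G_st_mult subring_add[OF L] subring_mult[OF L])
  qed
  then show ?thesis ..
qed

text \<open>The z_i are the roots of a polynomial over K, so \<open>g\<close> maps each of them to
  one of them; being injective on L, it permutes them.\<close>

lemma G_st_permutes:
  assumes z: "\<And>i. i \<in> {1..n} \<Longrightarrow> z i \<in> rat_fun_field n" "inj_on z {1..n}"
    and es: "\<And>i. i \<in> {1..n} \<Longrightarrow> elem_sym n z i \<in> base_field n"
  obtains \<pi> where "\<pi> permutes {1..n}" "\<And>i. i \<in> {1..n} \<Longrightarrow> g (z i) = z (\<pi> i)"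
proof -
  note K = subfield_imp_subring[OF subfield_base_field]
  let ?f = "\<Prod>i\<in>{1..n}. [:- z i, 1:]"
  have f: "?f \<in> poly_over (base_field n)" by (rule prod_linear_over[OF K es])
  have "\<exists>m. m \<in> {1..n} \<and> g (z i) = z m" if "i \<in> {1..n}" for i
  proof -
    have "poly ?f (z i) = 0" using that by (auto simp: poly_prod)
    then have "poly ?f (g (z i)) = 0"
      using G_st_poly[OF f z(1)[OF that]] G_st_base[OF subring_zero[OF K]] by simp
    then show ?thesis by (auto simp: poly_prod)
  qed
  then obtain s where s: "s i \<in> {1..n}" "g (z i) = z (s i)" if "i \<in> {1..n}" for i
    by metis
  \<comment> \<open>\<open>permutes\<close> asks for the identity outside {1..n}.\<close>
  define \<pi> where "\<pi> i = (if i \<in> {1..n} then s i else i)" for i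
  have "inj_on \<pi> {1..n}"
  proof (rule inj_onI)
    fix i j assume ij: "i \<in> {1..n}" "j \<in> {1..n}" "\<pi> i = \<pi> j"
    then have "g (z i) = g (z j)" using s by (simp add: \<pi>_def)
    then have "z i = z j" using inj_onD[OF G_st_inj] z(1) ij by blast
    then show "i = j" using inj_onD[OF z(2)] ij by blast
  qed
  moreover have "\<pi> ` {1..n} \<subseteq> {1..n}" using s by (auto simp: \<pi>_def)
  ultimately have "bij_betw \<pi> {1..n} {1..n}"
    using endo_inj_surj[of "{1..n}" \<pi>] by (auto simp: bij_betw_def)
  then have "\<pi> permutes {1..n}"
    by (rule bij_imp_permutes) (auto simp: \<pi>_def)
  moreover have "g (z i) = z (\<pi> i)" if "i \<in> {1..n}" for i
    using s(2)[OF that] that by (simp add: \<pi>_def)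
  ultimately show thesis by (rule that)
qed

end

lemma elem_sym_base_field:
  "i \<in> {1..n} \<Longrightarrow> elem_sym n x_var i \<in> base_field n"
  "i \<in> {1..n} \<Longrightarrow> elem_sym n y_var i \<in> base_field n"
  unfolding base_field_def by (rule adjoin_genI, simp)+

text \<open>An automorphism is determined by its values on the variables, since the elements of L on
  which \<open>g\<close> and the permutation action agree form a subfield. The restriction to L
  matches the extensional encoding of the group.\<close>

lemma G_st_carrierE:
  fixes g :: "'k::field rat_fun \<Rightarrow> 'k rat_fun"
  assumes g: "g \<in> carrier (G_st n)"
  obtains \<sigma> \<tau> where "\<sigma> permutes {1..n}" "\<tau> permutes {1..n}"
    "g = restrict (perm_act \<sigma> \<tau>) (rat_fun_field n)"
proof -
  let ?L = "rat_fun_field n :: 'k rat_fun set"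
  have L: "subring_of_type ?L" by (rule subfield_imp_subring[OF subfield_rat_fun_field])
  note closed = subring_of_type_closed[OF L]
  obtain \<sigma> where \<sigma>: "\<sigma> permutes {1..n}" "\<And>i. i \<in> {1..n} \<Longrightarrow> g (x_var i) = x_var (\<sigma> i)"
    by (rule G_st_permutes[OF g, of x_var])
      (auto simp: rat_fun_field_gens elem_sym_base_field inj_on_def x_var_eq_iff)
  obtain \<tau> where \<tau>: "\<tau> permutes {1..n}" "\<And>i. i \<in> {1..n} \<Longrightarrow> g (y_var i) = y_var (\<tau> i)"
    by (rule G_st_permutes[OF g, of y_var])
      (auto simp: rat_fun_field_gens elem_sym_base_field inj_on_def y_var_eq_iff)
  note bij = permutes_bij[OF \<sigma>(1)] permutes_bij[OF \<tau>(1)]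
  let ?\<phi> = "perm_act \<sigma> \<tau> :: 'k rat_fun \<Rightarrow> _"
  interpret field_map ?\<phi> by (rule field_map_perm_act[OF bij])
  have g1: "g 1 = 1" by (rule G_st_one[OF g])
  have g0: "g 0 = 0" by (rule G_st_base[OF g subring_zero[OF subfield_imp_subring[OF subfield_base_field]]])
  have guminus: "g (- a) = - g a" if "a \<in> ?L" for a
    using G_st_add[OF g that closed(3)[OF that]] g0 by (simp add: eq_neg_iff_add_eq_0 add.commute)
  have ginverse: "g (inverse a) = inverse (g a)" if "a \<in> ?L" for a
  proof (cases "a = 0")
    case False
    then have "g a * g (inverse a) = 1"
      using G_st_mult[OF g that subfield_inverse[OF subfield_rat_fun_field that]] g1 by simp
    then show ?thesis by (metis inverse_unique)
  qed (simp add: g0)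
  have "subfield_of_type {a \<in> ?L. g a = ?\<phi> a}"
    by (intro subfield_of_typeI subring_of_typeI)
      (auto simp: closed subfield_inverse[OF subfield_rat_fun_field] g1 guminus ginverse G_st_add[OF g] G_st_mult[OF g] map_one map_add map_mult map_uminus map_inverse)
  moreover have "const_rf c \<in> base_field n" for c :: 'k
    by (auto simp: base_field_def intro: adjoin_baseI)
  ultimately have "?L \<subseteq> {a \<in> ?L. g a = ?\<phi> a}"
    unfolding rat_fun_field_def[of n]
    by (intro adjoin_least; fold rat_fun_field_def)
      (auto simp: rat_fun_field_gens \<sigma> \<tau> perm_act_x perm_act_y perm_act_const bij G_st_base[OF g])
  moreover have "g \<in> extensional ?L" using g by (simp add: G_st_def galois_group_def)
  ultimately have "g = restrict ?\<phi> ?L"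
    by (intro extensionalityI[of _ ?L]) auto
  then show thesis by (rule that[OF \<sigma>(1) \<tau>(1)])
qed

lemma perm_act_in_carrier:
  assumes \<sigma>: "\<sigma> permutes {1..n}" and \<tau>: "\<tau> permutes {1..n}"
  shows "restrict (perm_act \<sigma> \<tau>) (rat_fun_field n) \<in> carrier (G_st n :: ('k::field rat_fun \<Rightarrow> _) monoid)"
proof -
  let ?L = "rat_fun_field n :: 'k rat_fun set"
  have L: "subring_of_type ?L" by (rule subfield_imp_subring[OF subfield_rat_fun_field])
  note closed = subring_of_type_closed[OF L]
  note bij = permutes_bij[OF \<sigma>(1)] permutes_bij[OF \<tau>(1)]
  let ?\<phi> = "perm_act \<sigma> \<tau> :: 'k rat_fun \<Rightarrow> _"
  interpret field_map ?\<phi> by (rule field_map_perm_act[OF bij])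
  have "bij_betw ?\<phi> ?L ?L"
    by (rule bij_betw_byWitness[where f' = "perm_act (inv_fun \<sigma>) (inv_fun \<tau>)"])
      (auto simp: perm_act_inv bij intro!: perm_act_rat_fun_field \<sigma> \<tau> permutes_inv)
  moreover have "?\<phi> a \<in> ?L" if "a \<in> ?L" for a using perm_act_rat_fun_field[OF \<sigma> \<tau> that] .
  moreover have "a \<in> ?L" "?\<phi> a = a" if "a \<in> base_field n" for a
    using that base_field_subset perm_act_base_field[OF \<sigma> \<tau>] by blast+
  ultimately show ?thesis
    using closed
    by (auto simp: G_st_def galois_group_def ring_iso_def ring_hom_def map_add map_mult map_one bij_betw_restrict_eq)
qed

lemma G_st_mult_eq:
  "g \<otimes>\<^bsub>G_st n\<^esub> h = compose (rat_fun_field n) h g"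
  by (simp add: G_st_def galois_group_def)

lemma G_st_inv:
  fixes \<sigma> \<tau> :: "nat \<Rightarrow> nat" and n :: nat
  assumes \<sigma>: "\<sigma> permutes {1..n}" and \<tau>: "\<tau> permutes {1..n}"
  shows "inv\<^bsub>G_st n\<^esub> (restrict (perm_act \<sigma> \<tau>) (rat_fun_field n :: 'k::field rat_fun set)) =
    restrict (perm_act (inv_fun \<sigma>) (inv_fun \<tau>)) (rat_fun_field n)"
    (is "inv\<^bsub>G_st n\<^esub> ?g = ?h")
proof -
  let ?L = "rat_fun_field n :: 'k rat_fun set"
  note bij = permutes_bij[OF \<sigma>(1)] permutes_bij[OF \<tau>(1)]
  note inv = permutes_inv[OF \<sigma>(1)] permutes_inv[OF \<tau>(1)]
  have L: "perm_act \<sigma> \<tau> a \<in> ?L" "perm_act (inv_fun \<sigma>) (inv_fun \<tau>) a \<in> ?L" if "a \<in> ?L" for a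
    using that \<sigma> \<tau> inv by (auto intro: perm_act_rat_fun_field)
  have one: "\<one>\<^bsub>G_st n\<^esub> = (\<lambda>a\<in>?L. a)" by (simp add: G_st_def galois_group_def)
  show ?thesis
    unfolding m_inv_def
  proof (rule the_equality)
    show "?h \<in> carrier (G_st n) \<and> ?g \<otimes>\<^bsub>G_st n\<^esub> ?h = \<one>\<^bsub>G_st n\<^esub> \<and> ?h \<otimes>\<^bsub>G_st n\<^esub> ?g = \<one>\<^bsub>G_st n\<^esub>"
      using perm_act_in_carrier[OF inv] L
      by (auto simp: one G_st_mult_eq compose_def fun_eq_iff perm_act_inv bij)
    fix y assume y: "y \<in> carrier (G_st n) \<and> ?g \<otimes>\<^bsub>G_st n\<^esub> y = \<one>\<^bsub>G_st n\<^esub> \<and> y \<otimes>\<^bsub>G_st n\<^esub> ?g = \<one>\<^bsub>G_st n\<^esub>"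
    then have "?g \<otimes>\<^bsub>G_st n\<^esub> y = (\<lambda>a\<in>?L. a)" by (simp add: one)
    then have *: "y (perm_act \<sigma> \<tau> a) = a" if "a \<in> ?L" for a
      using that by (auto simp: G_st_mult_eq compose_def dest!: fun_cong[where x = a])
    have "y b = perm_act (inv_fun \<sigma>) (inv_fun \<tau>) b" if "b \<in> ?L" for b
      using *[OF L(2)[OF that]] by (simp add: perm_act_inv bij)
    moreover have "y \<in> extensional ?L" using y by (simp add: G_st_def galois_group_def)
    ultimately show "y = ?h" by (intro extensionalityI[of _ ?L]) auto
  qed
qed

lemma diag_subgroup_eq:
  "(diag_subgroup n :: ('k::field rat_fun \<Rightarrow> _) set) =
    {restrict (perm_act \<pi> \<pi>) (rat_fun_field n) | \<pi>. \<pi> permutes {1..n}}" (is "?D = ?R")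
proof (intro equalityI subsetI)
  fix g assume "g \<in> ?R"
  then obtain \<pi> where "\<pi> permutes {1..n}" "g = restrict (perm_act \<pi> \<pi>) (rat_fun_field n)" by blast
  then show "g \<in> ?D"
    using perm_act_in_carrier[of \<pi> n \<pi>, where ?'k = 'k]
    by (auto simp: diag_subgroup_def perm_act_x perm_act_y permutes_bij rat_fun_field_gens)
next
  fix g assume "g \<in> ?D"
  then obtain \<pi> where g: "g \<in> carrier (G_st n)" and \<pi>: "\<pi> permutes {1..n}"
    "\<And>i. i \<in> {1..n} \<Longrightarrow> g (x_var i) = x_var (\<pi> i) \<and> g (y_var i) = y_var (\<pi> i)"
    by (auto simp: diag_subgroup_def)
  obtain \<sigma> \<tau> where st: "\<sigma> permutes {1..n}" "\<tau> permutes {1..n}"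
    "g = restrict (perm_act \<sigma> \<tau>) (rat_fun_field n)" using G_st_carrierE[OF g] .
  have *: "\<sigma> i = \<pi> i \<and> \<tau> i = \<pi> i" if "i \<in> {1..n}" for i
    using \<pi>(2)[OF that] that st
    by (auto simp: rat_fun_field_gens perm_act_x perm_act_y permutes_bij x_var_eq_iff y_var_eq_iff)
  have "\<sigma> = \<pi>" "\<tau> = \<pi>"
    using * permutes_not_in[OF st(1)] permutes_not_in[OF st(2)] permutes_not_in[OF \<pi>(1)]
    by (metis ext)+
  then show "g \<in> ?R" using st by blast
qed

text \<open>The product of \<open>G_st\<close> composes from left to right, so g^-1 h g acts by g^-1
  first, then h, then g; for h given by \<pi> on both sides this is the pair of \<sigma> \<pi>
  \<sigma>^-1 and \<tau> \<pi> \<tau>^-1.\<close>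

lemma fixed_field_conj_diag:
  fixes \<sigma> \<tau> :: "nat \<Rightarrow> nat" and n :: nat
  assumes \<sigma>: "\<sigma> permutes {1..n}" and \<tau>: "\<tau> permutes {1..n}"
  defines "g \<equiv> restrict (perm_act \<sigma> \<tau>) (rat_fun_field n :: 'k::field rat_fun set)"
  shows "fixed_field (rat_fun_field n) (inv\<^bsub>G_st n\<^esub> g <#\<^bsub>G_st n\<^esub> diag_subgroup n #>\<^bsub>G_st n\<^esub> g) =
    {a \<in> rat_fun_field n. \<forall>\<pi>. \<pi> permutes {1..n} \<longrightarrow>
      perm_act (\<sigma> \<circ> \<pi> \<circ> inv_fun \<sigma>) (\<tau> \<circ> \<pi> \<circ> inv_fun \<tau>) a = a}"
proof -
  let ?L = "rat_fun_field n :: 'k rat_fun set"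
  note bij = permutes_bij[OF \<sigma>] permutes_bij[OF \<tau>]
  let ?h = "restrict (perm_act (inv_fun \<sigma>) (inv_fun \<tau>)) ?L"
  have inv: "inv\<^bsub>G_st n\<^esub> g = ?h" unfolding g_def by (rule G_st_inv[OF \<sigma> \<tau>])
  have ev: "(?h \<otimes>\<^bsub>G_st n\<^esub> restrict (perm_act \<pi> \<pi>) ?L \<otimes>\<^bsub>G_st n\<^esub> g) a =
      perm_act (\<sigma> \<circ> \<pi> \<circ> inv_fun \<sigma>) (\<tau> \<circ> \<pi> \<circ> inv_fun \<tau>) a"
    if "\<pi> permutes {1..n}" "a \<in> ?L" for \<pi> a
  proof -
    have "perm_act (inv_fun \<sigma>) (inv_fun \<tau>) a \<in> ?L"
      by (intro perm_act_rat_fun_field permutes_inv \<sigma> \<tau> that)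
    then have "perm_act \<pi> \<pi> (perm_act (inv_fun \<sigma>) (inv_fun \<tau>) a) \<in> ?L"
      "perm_act (inv_fun \<sigma>) (inv_fun \<tau>) a \<in> ?L"
      by (auto intro: perm_act_rat_fun_field that)
    moreover have "bij \<pi>" using that by (auto intro: permutes_bij)
    ultimately show ?thesis
      using that(2) bij
      by (simp add: G_st_mult_eq compose_def g_def perm_act_compose bij_imp_bij_inv bij_comp o_assoc)
  qed
  have "inv\<^bsub>G_st n\<^esub> g <#\<^bsub>G_st n\<^esub> diag_subgroup n #>\<^bsub>G_st n\<^esub> g =
     {?h \<otimes>\<^bsub>G_st n\<^esub> restrict (perm_act \<pi> \<pi>) ?L \<otimes>\<^bsub>G_st n\<^esub> g | \<pi>. \<pi> permutes {1..n}}"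
    unfolding l_coset_def r_coset_def diag_subgroup_eq inv by blast
  then show ?thesis
    unfolding fixed_field_def using ev by auto
qed

section \<open>Fixed fields of stabilizers\<close>

definition orbit_of :: "nat \<Rightarrow> 'k::field rat_fun \<Rightarrow> 'k rat_fun set" where
  "orbit_of n w = (\<lambda>(\<sigma>, \<tau>). perm_act \<sigma> \<tau> w) ` perm_pairs n"

lemma finite_orbit: "finite (orbit_of n w)"
  by (simp add: orbit_of_def finite_perm_pairs)

lemma self_in_orbit: "w \<in> orbit_of n w"
  by (auto simp: orbit_of_def perm_pairs_def perm_act_id permutes_id[unfolded id_def]
    intro!: image_eqI[of _ _ "(\<lambda>x. x, \<lambda>x. x)"])

lemma orbit_perm_act:
  assumes \<sigma>: "\<sigma> permutes {1..n}" and \<tau>: "\<tau> permutes {1..n}"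
  shows "perm_act \<sigma> \<tau> ` orbit_of n w = orbit_of n w"
proof -
  have "perm_act \<sigma> \<tau> ` orbit_of n w =
      (\<lambda>p. (\<lambda>(\<sigma>, \<tau>). perm_act \<sigma> \<tau> w) ((\<lambda>(\<alpha>, \<beta>). (\<sigma> \<circ> \<alpha>, \<tau> \<circ> \<beta>)) p)) ` perm_pairs n"
    unfolding orbit_of_def image_image
    by (rule image_cong) (use \<sigma> \<tau> in \<open>auto simp: perm_pairs_def perm_act_compose permutes_bij\<close>)
  also have "\<dots> = orbit_of n w"
    unfolding orbit_of_def using perm_act_reindex(1)[OF \<sigma> \<tau>] by (metis image_image)
  finally show ?thesis .
qed

definition invariants_of_stabilizer :: "nat \<Rightarrow> 'k::field rat_fun \<Rightarrow> 'k rat_fun set" where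
  "invariants_of_stabilizer n w = {a \<in> rat_fun_field n. \<forall>\<sigma> \<tau>. \<sigma> permutes {1..n} \<longrightarrow>
     \<tau> permutes {1..n} \<longrightarrow> perm_act \<sigma> \<tau> w = w \<longrightarrow> perm_act \<sigma> \<tau> a = a}"

lemma invariants_of_stabilizer_poly:
  fixes w a :: "'k::field rat_fun"
  assumes w: "w \<in> rat_fun_field n" and a: "a \<in> invariants_of_stabilizer n w"
  obtains Q where "Q \<in> poly_over (base_field n)" "Polynomial.degree Q < card (orbit_of n w)"
    "poly Q w = a"
proof -
  let ?L = "rat_fun_field n :: 'k rat_fun set" and ?W = "orbit_of n w"
  have aL: "a \<in> ?L" and stab: "\<And>\<sigma> \<tau>. \<sigma> permutes {1..n} \<Longrightarrow> \<tau> permutes {1..n} \<Longrightarrow>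
      perm_act \<sigma> \<tau> w = w \<Longrightarrow> perm_act \<sigma> \<tau> a = a"
    using a by (auto simp: invariants_of_stabilizer_def)
  have WL: "?W \<subseteq> ?L"
    using perm_act_rat_fun_field w by (auto simp: orbit_of_def perm_pairs_def)
  \<comment> \<open>If two pairs send w to the same point, their quotient stabilizes w and therefore
    fixes \<open>a\<close>; this makes \<open>h\<close> well defined on the orbit.\<close>
  have wd: "perm_act \<sigma> \<tau> a = perm_act \<alpha> \<beta> a"
    if p: "\<sigma> permutes {1..n}" "\<tau> permutes {1..n}" "\<alpha> permutes {1..n}" "\<beta> permutes {1..n}"
      and eq: "perm_act \<sigma> \<tau> w = perm_act \<alpha> \<beta> w" for \<sigma> \<tau> \<alpha> \<beta>
  proof -
    note b = p[THEN permutes_bij] and i = p[THEN permutes_inv]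
    have c: "perm_act (inv_fun \<alpha>) (inv_fun \<beta>) (perm_act \<sigma> \<tau> c) =
        perm_act (inv_fun \<alpha> \<circ> \<sigma>) (inv_fun \<beta> \<circ> \<tau>) c" for c :: "'k rat_fun"
      by (rule perm_act_compose) (use b i[THEN permutes_bij] in auto)
    have "perm_act (inv_fun \<alpha> \<circ> \<sigma>) (inv_fun \<beta> \<circ> \<tau>) a = a"
    proof (rule stab)
      show "perm_act (inv_fun \<alpha> \<circ> \<sigma>) (inv_fun \<beta> \<circ> \<tau>) w = w"
        using c[of w] by (simp add: eq perm_act_inv b)
    qed (use p i in \<open>auto intro: permutes_compose\<close>)
    then have "perm_act \<alpha> \<beta> (perm_act (inv_fun \<alpha>) (inv_fun \<beta>) (perm_act \<sigma> \<tau> a)) = perm_act \<alpha> \<beta> a"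
      using c[of a] by simp
    then show ?thesis by (simp add: perm_act_inv b)
  qed
  define h where "h v = (SOME b. \<exists>\<sigma> \<tau>. \<sigma> permutes {1..n} \<and> \<tau> permutes {1..n} \<and>
      v = perm_act \<sigma> \<tau> w \<and> b = perm_act \<sigma> \<tau> a)" for v
  have h: "h (perm_act \<sigma> \<tau> w) = perm_act \<sigma> \<tau> a"
    if "\<sigma> permutes {1..n}" "\<tau> permutes {1..n}" for \<sigma> \<tau>
  proof -
    have "\<exists>\<alpha> \<beta>. \<alpha> permutes {1..n} \<and> \<beta> permutes {1..n} \<and>
      perm_act \<sigma> \<tau> w = perm_act \<alpha> \<beta> w \<and> h (perm_act \<sigma> \<tau> w) = perm_act \<alpha> \<beta> a"
      unfolding h_def by (rule someI_ex) (use that in blast)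
    then show ?thesis using wd that by metis
  qed
  define Q where "Q = lagrange ?W h"
  have ne: "?W \<noteq> {}" using self_in_orbit by blast
  have Qdeg: "Polynomial.degree Q < card ?W"
    unfolding Q_def by (rule lagrange_degree[OF finite_orbit ne])
  have Qval: "poly Q v = h v" if "v \<in> ?W" for v
    unfolding Q_def by (rule lagrange_poly[OF finite_orbit that])
  have QL: "Q \<in> poly_over ?L"
    unfolding Q_def
  proof (rule lagrange_over[OF subfield_rat_fun_field WL])
    fix v assume "v \<in> ?W"
    then show "h v \<in> ?L"
      by (auto simp: orbit_of_def perm_pairs_def h intro!: perm_act_rat_fun_field aL)
  qed
  \<comment> \<open>Conjugating the coefficients gives a polynomial with value \<phi>(h v') at
    \<phi> v'. As \<phi> permutes the orbit and h(\<phi> v') = \<phi>(h v'), it interpolates the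
    same data as \<open>Q\<close>, and the degree bound forces equality.\<close>
  have Qinv: "map_poly (perm_act \<sigma> \<tau>) Q = Q" if p: "\<sigma> permutes {1..n}" "\<tau> permutes {1..n}" for \<sigma> \<tau>
  proof -
    note bij = p[THEN permutes_bij]
    let ?\<phi> = "perm_act \<sigma> \<tau> :: 'k rat_fun \<Rightarrow> _"
    interpret field_map ?\<phi> by (rule field_map_perm_act[OF bij])
    show ?thesis
    proof (rule poly_eqI_degree[of ?W])
      fix v assume "v \<in> ?W"
      then obtain v' where v': "v' \<in> ?W" "v = ?\<phi> v'" using orbit_perm_act[OF p, of w] by blast
      then obtain \<alpha> \<beta> where ab: "\<alpha> permutes {1..n}" "\<beta> permutes {1..n}" "v' = perm_act \<alpha> \<beta> w"
        by (auto simp: orbit_of_def perm_pairs_def)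
      have e: "?\<phi> (perm_act \<alpha> \<beta> c) = perm_act (\<sigma> \<circ> \<alpha>) (\<tau> \<circ> \<beta>) c" for c
        by (rule perm_act_compose) (use bij ab(1,2)[THEN permutes_bij] in auto)
      have "h v = ?\<phi> (h v')"
        unfolding v'(2) ab(3)
        by (simp only: e h[OF ab(1,2)] h[OF permutes_compose[OF ab(1) p(1)] permutes_compose[OF ab(2) p(2)]])
      then show "poly (map_poly ?\<phi> Q) v = poly Q v"
        using Qval[OF v'(1)] Qval[OF \<open>v \<in> ?W\<close>] poly_map_poly[of Q v'] v'(2) by simp
    qed (simp_all add: degree_map_poly' Qdeg)
  qed
  have "Q \<in> poly_over (base_field n)"
    unfolding poly_over_def
  proof (intro CollectI allI invariant_in_base_field)
    fix i
    show "Polynomial.coeff Q i \<in> ?L" using QL by (rule poly_over_coeff)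
    fix \<sigma> \<tau> assume p: "\<sigma> permutes {1..n}" "\<tau> permutes {1..n}"
    have "perm_act \<sigma> \<tau> (0 :: 'k rat_fun) = 0"
      by (rule ring_map.map_zero[OF field_map.axioms(1)[OF field_map_perm_act[OF p[THEN permutes_bij]]]])
    then show "perm_act \<sigma> \<tau> (Polynomial.coeff Q i) = Polynomial.coeff Q i"
      using Qinv[OF p] by (metis coeff_map_poly)
  qed
  moreover have "poly Q w = a"
    using Qval[OF self_in_orbit] h[of "\<lambda>x. x" "\<lambda>x. x"]
    by (simp add: perm_act_id permutes_id[unfolded id_def])
  ultimately show thesis using Qdeg by (intro that)
qed

lemma poly_over_perm_act:
  assumes p: "\<sigma> permutes {1..n}" "\<tau> permutes {1..n}" and f: "f \<in> poly_over (base_field n)"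
  shows "perm_act \<sigma> \<tau> (poly f w) = poly f (perm_act \<sigma> \<tau> w)"
proof -
  interpret field_map "perm_act \<sigma> \<tau> :: 'a rat_fun \<Rightarrow> _"
    by (rule field_map_perm_act[OF p[THEN permutes_bij]])
  have "map_poly (perm_act \<sigma> \<tau>) f = f"
    using f by (intro poly_eqI) (simp add: coeff_map_poly map_zero perm_act_base_field[OF p] poly_over_def)
  then show ?thesis using poly_map_poly[of f w] by simp
qed

lemma subfield_invariants_of_stabilizer: "subfield_of_type (invariants_of_stabilizer n w)"
proof -
  note L = subfield_imp_subring[OF subfield_rat_fun_field, of n]
  have fm: "field_map (perm_act \<sigma> \<tau> :: 'a rat_fun \<Rightarrow> _)"
    if "\<sigma> permutes {1..n}" "\<tau> permutes {1..n}" for \<sigma> \<tau>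
    by (rule field_map_perm_act) (use that in \<open>auto intro: permutes_bij\<close>)
  note rm = field_map.axioms(1)[OF fm]
  show ?thesis
    unfolding invariants_of_stabilizer_def
    by (intro subfield_of_typeI subring_of_typeI)
      (auto simp: subring_of_type_closed[OF L] subfield_inverse[OF subfield_rat_fun_field] ring_map.map_add[OF rm] ring_map.map_mult[OF rm] ring_map.map_one[OF rm]
        ring_map.map_uminus[OF rm] field_map.map_inverse[OF fm])
qed

lemma adjoin_subset_invariants:
  assumes "S \<subseteq> invariants_of_stabilizer n w"
  shows "adjoin (base_field n) S \<subseteq> invariants_of_stabilizer n w"
  by (rule adjoin_least[OF subfield_invariants_of_stabilizer _ assms])
    (use base_field_subset in \<open>auto simp: invariants_of_stabilizer_def perm_act_base_field\<close>)

text \<open>The bound is put on the coefficients and not on the degree so that \<open>m\<close> = 0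
  gives {0} instead of the empty set.\<close>

definition poly_values :: "nat \<Rightarrow> 'k::field rat_fun \<Rightarrow> nat \<Rightarrow> 'k rat_fun set" where
  "poly_values n w m = {poly Q w | Q. Q \<in> poly_over (base_field n) \<and> (\<forall>i\<ge>m. Polynomial.coeff Q i = 0)}"

text \<open>A circle of inclusions: K(w) lies in the invariants, these are polynomial values at w by
  interpolation, and such values lie in K(w).\<close>

lemma adjoin_eq:
  assumes w: "w \<in> rat_fun_field n"
  shows "adjoin (base_field n) {w} = invariants_of_stabilizer n w"
    and "adjoin (base_field n) {w} = poly_values n w (card (orbit_of n w))"
proof -
  have 1: "adjoin (base_field n) {w} \<subseteq> invariants_of_stabilizer n w"
    by (rule adjoin_subset_invariants) (use w in \<open>simp add: invariants_of_stabilizer_def\<close>)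
  have 2: "invariants_of_stabilizer n w \<subseteq> poly_values n w (card (orbit_of n w))"
  proof
    fix a assume "a \<in> invariants_of_stabilizer n w"
    then obtain Q where "Q \<in> poly_over (base_field n)" "Polynomial.degree Q < card (orbit_of n w)" "poly Q w = a"
      by (rule invariants_of_stabilizer_poly[OF w])
    then show "a \<in> poly_values n w (card (orbit_of n w))"
      by (auto simp: poly_values_def intro!: exI[of _ Q] coeff_eq_0)
  qed
  have 3: "poly_values n w m \<subseteq> adjoin (base_field n) {w}" for m
  proof -
    note A = subfield_imp_subring[OF subfield_adjoin, of "base_field n" "{w}"]
    have "poly Q w \<in> adjoin (base_field n) {w}" if "Q \<in> poly_over (base_field n)" for Q
      by (rule poly_over_poly[OF A]) (use that in \<open>auto simp: poly_over_def intro: adjoin_baseI adjoin_genI\<close>)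
    then show ?thesis by (auto simp: poly_values_def)
  qed
  show "adjoin (base_field n) {w} = invariants_of_stabilizer n w"
    and "adjoin (base_field n) {w} = poly_values n w (card (orbit_of n w))"
    using 1 2 3 by (blast intro!: equalityI)+
qed

text \<open>The powers of w with exponents below the orbit size are linearly independent over K.
  Each step of the induction adjoins one more power by \<open>line_extension\<close>.\<close>

lemma dimension_poly_values:
  fixes w :: "'k::field rat_fun"
  assumes "m \<le> card (orbit_of n w)"
  shows "ring.dimension rat_fun_ring m (base_field n) (poly_values n w m)"
proof -
  interpret field "rat_fun_ring :: 'k rat_fun ring" by (rule field_from_type_algebra)
  note K = subfield_imp_subring[OF subfield_base_field, of n]
  show ?thesis using assms
  proof (induction m)
    case 0
    have "poly_values n w 0 = {0}"
      using subring_zero[OF subring_poly_over[OF K]]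
      by (auto simp: poly_values_def poly_eq_iff intro!: exI[of _ 0]) (metis poly_0 poly_eq_iff coeff_0)
    then show ?case using zero_dim[of "base_field n"] by simp
  next
    case (Suc m)
    have notin: "w ^ m \<notin> poly_values n w m"
    proof
      assume "w ^ m \<in> poly_values n w m"
      then obtain Q where Q: "Q \<in> poly_over (base_field n)" "\<forall>i\<ge>m. Polynomial.coeff Q i = 0" "w ^ m = poly Q w"
        by (auto simp: poly_values_def)
      \<comment> \<open>A relation would make w a root of this monic polynomial of degree
        \<open>m\<close>. Its coefficients are in K, so it vanishes on the whole orbit, which has
        more than \<open>m\<close> points.\<close>
      define P where "P = Polynomial.monom 1 m - Q"
      have P: "P \<in> poly_over (base_field n)"
        unfolding P_def by (intro subring_diff[OF subring_poly_over[OF K]] poly_over_monom[OF K] subring_one[OF K] Q)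
      have "P = 0"
      proof (rule poly_eqI_degree[of "orbit_of n w"])
        fix v assume "v \<in> orbit_of n w"
        then obtain \<sigma> \<tau> where st: "\<sigma> permutes {1..n}" "\<tau> permutes {1..n}" "v = perm_act \<sigma> \<tau> w"
          by (auto simp: orbit_of_def perm_pairs_def)
        have "poly P w = 0" by (simp add: P_def poly_monom Q(3))
        then have "poly P v = perm_act \<sigma> \<tau> 0"
          using poly_over_perm_act[OF st(1,2) P, of w] st(3) by simp
        also have "\<dots> = 0"
          by (rule perm_act_base_field[OF st(1,2) subring_zero[OF K]])
        finally show "poly P v = poly 0 v" by simp
      next
        have "Polynomial.degree P \<le> m"
          by (rule degree_le) (use Q(2) in \<open>auto simp: P_def\<close>)
        then show "Polynomial.degree P < card (orbit_of n w)" using Suc.prems by simp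
        show "Polynomial.degree (0 :: 'k rat_fun Polynomial.poly) < card (orbit_of n w)" using Suc.prems by simp
      qed
      then have "Polynomial.coeff P m = 0" by simp
      then show False using Q(2) by (simp add: P_def)
    qed
    have "poly_values n w (Suc m) = line_extension (base_field n) (w ^ m) (poly_values n w m)"
    proof (intro equalityI subsetI)
      fix a assume "a \<in> poly_values n w (Suc m)"
      then obtain Q where Q: "Q \<in> poly_over (base_field n)" "\<forall>i\<ge>Suc m. Polynomial.coeff Q i = 0" "a = poly Q w"
        by (auto simp: poly_values_def)
      let ?c = "Polynomial.coeff Q m"
      define P where "P = Q - Polynomial.monom ?c m"
      have c: "?c \<in> base_field n" by (rule poly_over_coeff[OF Q(1)])
      have "P \<in> poly_over (base_field n)"
        unfolding P_def by (intro subring_diff[OF subring_poly_over[OF K]] poly_over_monom[OF K] c Q)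
      moreover have "\<forall>i\<ge>m. Polynomial.coeff P i = 0"
      proof (intro allI impI)
        fix i assume "m \<le> i"
        then show "Polynomial.coeff P i = 0" using Q(2) by (cases "i = m") (auto simp: P_def)
      qed
      ultimately have "poly P w \<in> poly_values n w m" by (auto simp: poly_values_def)
      moreover have "a = ?c * w ^ m + poly P w" by (simp add: P_def poly_monom Q(3))
      ultimately show "a \<in> line_extension (base_field n) (w ^ m) (poly_values n w m)"
        using c by (auto simp: line_extension_mem_iff)
    next
      fix a assume "a \<in> line_extension (base_field n) (w ^ m) (poly_values n w m)"
      then obtain c Q where Q: "c \<in> base_field n" "Q \<in> poly_over (base_field n)"
        "\<forall>i\<ge>m. Polynomial.coeff Q i = 0" "a = c * w ^ m + poly Q w"
        by (auto simp: line_extension_mem_iff poly_values_def)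
      have "Polynomial.monom c m + Q \<in> poly_over (base_field n)"
        by (intro subring_add[OF subring_poly_over[OF K]] poly_over_monom[OF K] Q)
      then show "a \<in> poly_values n w (Suc m)"
        using Q by (auto simp: poly_values_def poly_monom intro!: exI[of _ "Polynomial.monom c m + Q"])
    qed
    then show ?case
      using Suc_dim[OF _ notin Suc.IH] Suc.prems by simp
  qed
qed

section \<open>The interpolation coefficients\<close>

text \<open>A polynomial of degree below n is determined by its values at n distinct nodes, so the
  definite description in \<open>interp_coeffs\<close> can be replaced by any polynomial that solves
  the problem.\<close>

lemma interp_coeffs_eq:
  fixes a b :: "nat \<Rightarrow> 'k::field rat_fun"
  assumes inj: "inj_on a {1..n}"
    and P: "Polynomial.degree P < n" "P \<in> poly_over (rat_fun_field n)"
      "\<And>i. i \<in> {1..n} \<Longrightarrow> poly P (a i) = b i"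
    and j: "j < n"
  shows "interp_coeffs n a b j = Polynomial.coeff P j"
proof -
  have ev: "poly P z = (\<Sum>j<n. Polynomial.coeff P j * z ^ j)" for z
  proof -
    have "poly P z = (\<Sum>j\<le>Polynomial.degree P. Polynomial.coeff P j * z ^ j)" by (rule poly_altdef)
    also have "\<dots> = (\<Sum>j<n. Polynomial.coeff P j * z ^ j)"
      by (rule sum.mono_neutral_left) (use P(1) in \<open>auto simp: coeff_eq_0\<close>)
    finally show ?thesis .
  qed
  have "interp_coeffs n a b = restrict (Polynomial.coeff P) {..<n}"
    unfolding interp_coeffs_def
  proof (rule the_equality)
    show "restrict (Polynomial.coeff P) {..<n} \<in> {..<n} \<rightarrow>\<^sub>E rat_fun_field n \<and>
      (\<forall>i\<in>{1..n}. b i = (\<Sum>j<n. restrict (Polynomial.coeff P) {..<n} j * a i ^ j))"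
      using P(2) by (auto simp: poly_over_def ev simp flip: P(3))
    fix c assume c: "c \<in> {..<n} \<rightarrow>\<^sub>E rat_fun_field n \<and> (\<forall>i\<in>{1..n}. b i = (\<Sum>j<n. c j * a i ^ j))"
    define Q where "Q = (\<Sum>j<n. Polynomial.monom (c j) j)"
    have cQ: "Polynomial.coeff Q l = (if l < n then c l else 0)" for l
      by (simp add: Q_def coeff_sum)
    have "Polynomial.degree Q < n"
      using j degree_le[of "n - 1" Q] cQ by fastforce
    moreover have "poly Q (a i) = poly P (a i)" if "i \<in> {1..n}" for i
      using c that P(3)[OF that] by (simp add: Q_def poly_sum poly_monom)
    ultimately have "Q = P"
      using P(1) inj by (intro poly_eqI_degree[of "a ` {1..n}"]) (auto simp: card_image)
    then show "c = restrict (Polynomial.coeff P) {..<n}"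
      using c cQ by (intro extensionalityI[of _ "{..<n}"]) (auto simp: PiE_def)
  qed
  then show ?thesis using j by simp
qed

section \<open>The coefficients of the Lagrange basis at x_1, ..., x_n\<close>

abbreviation x_basis :: "nat \<Rightarrow> nat \<Rightarrow> 'k::field rat_fun Polynomial.poly" where
  "x_basis n j \<equiv> lagrange_basis (x_var ` {1..n}) (x_var j)"

lemma card_x_var: "card (x_var ` A :: 'k::field rat_fun set) = card A"
  by (simp add: card_image inj_on_def x_var_eq_iff)

lemma x_basis_poly:
  "j \<in> {1..n} \<Longrightarrow> m \<in> {1..n} \<Longrightarrow> poly (x_basis n j) (x_var m) = (if m = j then 1 else 0)"
  by (simp add: lagrange_basis_poly x_var_eq_iff)

lemma x_basis_degree:
  "j \<in> {1..n} \<Longrightarrow> Polynomial.degree (x_basis n j :: 'k::field rat_fun Polynomial.poly) < n"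
  using lagrange_basis_degree[of "x_var ` {1..n} :: 'k rat_fun set" "x_var j"] by (simp add: card_x_var)

text \<open>Both sides come from polynomials that agree on the permuted nodes. The coefficients
  involve x only, so \<open>\<tau>\<close> is an arbitrary bijection and may carry y_m to
  y_{n+1}.\<close>

lemma perm_act_x_basis:
  fixes i j :: nat
  assumes \<sigma>: "\<sigma> permutes {1..n}" and \<tau>: "bij \<tau>" and j: "j \<in> {1..n}"
  shows "perm_act \<sigma> \<tau> (Polynomial.coeff (x_basis n j :: 'k::field rat_fun Polynomial.poly) i) =
    Polynomial.coeff (x_basis n (\<sigma> j)) i"
proof -
  note bij = permutes_bij[OF \<sigma>] \<tau>
  let ?\<phi> = "perm_act \<sigma> \<tau> :: 'k rat_fun \<Rightarrow> _"
  interpret field_map ?\<phi> by (rule field_map_perm_act[OF bij])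
  have \<sigma>j: "\<sigma> j \<in> {1..n}" using permutes_in_image[OF \<sigma>] j by simp
  have "map_poly ?\<phi> (x_basis n j) = x_basis n (\<sigma> j)"
  proof (rule poly_eqI_degree[of "x_var ` {1..n}"])
    fix w :: "'k rat_fun" assume "w \<in> x_var ` {1..n}"
    then obtain m where m: "m \<in> {1..n}" "w = x_var (\<sigma> m)"
      using permutes_image[OF \<sigma>] by (metis imageE)
    have \<sigma>m: "\<sigma> m \<in> {1..n}" using permutes_in_image[OF \<sigma>] m by simp
    have "poly (map_poly ?\<phi> (x_basis n j)) w = ?\<phi> (poly (x_basis n j) (x_var m))"
      using poly_map_poly[of "x_basis n j" "x_var m"] m(2) by (simp add: perm_act_x bij)
    also have "\<dots> = (if m = j then 1 else 0)"
      unfolding x_basis_poly[OF j m(1)] by (simp add: map_zero map_one)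
    also have "\<dots> = poly (x_basis n (\<sigma> j)) w"
      unfolding m(2) x_basis_poly[OF \<sigma>j \<sigma>m] using permutes_inj[OF \<sigma>] by (simp add: inj_eq)
    finally show "poly (map_poly ?\<phi> (x_basis n j)) w = poly (x_basis n (\<sigma> j)) w" .
  qed (use x_basis_degree[OF j] x_basis_degree[OF \<sigma>j] in \<open>simp_all add: degree_map_poly' card_x_var\<close>)
  then show ?thesis by (metis coeff_map_poly map_zero)
qed

definition interp_xy :: "nat \<Rightarrow> 'k::field rat_fun Polynomial.poly" where
  "interp_xy n = (\<Sum>j\<in>{1..n}. smult (y_var j) (x_basis n j))"

lemma interp_xy_poly: "i \<in> {1..n} \<Longrightarrow> poly (interp_xy n) (x_var i) = y_var i"
proof -
  assume i: "i \<in> {1..n}"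
  have "poly (interp_xy n) (x_var i) = (\<Sum>j\<in>{1..n}. y_var j * (if i = j then 1 else 0))"
    unfolding interp_xy_def poly_sum poly_smult
    by (intro sum.cong refl) (simp only: x_basis_poly[OF _ i])
  also have "\<dots> = y_var i" using i by (simp add: if_distrib cong: if_cong)
  finally show ?thesis .
qed

lemma interp_xy_degree:
  "n > 0 \<Longrightarrow> Polynomial.degree (interp_xy n :: 'k::field rat_fun Polynomial.poly) < n"
proof -
  assume n: "n > 0"
  have "Polynomial.degree (interp_xy n :: 'k rat_fun Polynomial.poly) \<le> n - 1"
    unfolding interp_xy_def
  proof (rule degree_sum_le)
    fix j assume "j \<in> {1..n}"
    then show "Polynomial.degree (smult (y_var j) (x_basis n j) :: 'k rat_fun Polynomial.poly) \<le> n - 1"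
      using x_basis_degree[of j n, where ?'k = 'k]
        degree_smult_le[of "y_var j" "x_basis n j :: 'k rat_fun Polynomial.poly"] by linarith
  qed simp
  then show ?thesis using n by simp
qed

lemma interp_xy_over: "interp_xy n \<in> poly_over (rat_fun_field n)"
proof -
  note L = subfield_imp_subring[OF subfield_rat_fun_field]
  show ?thesis
    unfolding interp_xy_def
    by (intro subring_sum[OF subring_poly_over[OF L]] poly_over_smult[OF L]
      lagrange_basis_over[OF subfield_rat_fun_field] image_subsetI rat_fun_field_gens)
qed

lemma u_coeff_eq:
  assumes "i < n"
  shows "u_coeff n i = Polynomial.coeff (interp_xy n) i"
  unfolding u_coeff_def
  by (rule interp_coeffs_eq)
    (use assms in \<open>auto simp: inj_on_def x_var_eq_iff interp_xy_poly interp_xy_over interp_xy_degree\<close>)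

lemma u_coeff_sum:
  assumes "i < n"
  shows "u_coeff n i = (\<Sum>j\<in>{1..n}. y_var j * Polynomial.coeff (x_basis n j) i)"
  by (simp add: u_coeff_eq[OF assms] interp_xy_def coeff_sum)

text \<open>Otherwise the relation would persist after x_1 is replaced by x_{n+1}, and the
  difference would give x_{n+1}^r = x_1^r. The argument is independent of the
  characteristic.\<close>

lemma power_sum_x_neq_0:
  assumes "n > 0" "r > 0"
  shows "(\<Sum>j\<in>{1..n}. x_var j ^ r) \<noteq> (0 :: 'k::field rat_fun)"
proof
  assume eq: "(\<Sum>j\<in>{1..n}. x_var j ^ r) = (0 :: 'k rat_fun)"
  define s where "s = transpose 1 (Suc n)"
  have bij: "bij s" "bij (\<lambda>i. i :: nat)" by (simp_all add: s_def bij_id[unfolded id_def])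
  let ?\<phi> = "perm_act s (\<lambda>i. i) :: 'k rat_fun \<Rightarrow> _"
  interpret field_map ?\<phi> by (rule field_map_perm_act[OF bij])
  have ins: "{1..n} = insert 1 {2..n}" using assms by auto
  have 1: "x_var 1 ^ r + (\<Sum>j\<in>{2..n}. x_var j ^ r) = (0 :: 'k rat_fun)"
    using eq unfolding ins by simp
  then have "?\<phi> (x_var 1 ^ r + (\<Sum>j\<in>{2..n}. x_var j ^ r)) = 0" by (simp add: map_zero)
  then have "x_var (s 1) ^ r + (\<Sum>j\<in>{2..n}. x_var (s j) ^ r) = (0 :: 'k rat_fun)"
    by (simp add: map_add map_sum map_power perm_act_x[OF bij])
  moreover have "(\<Sum>j\<in>{2..n}. x_var (s j) ^ r) = (\<Sum>j\<in>{2..n}. x_var j ^ r :: 'k rat_fun)"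
    by (rule sum.cong) (auto simp: s_def transpose_def)
  ultimately have "x_var (Suc n) ^ r + (\<Sum>j\<in>{2..n}. x_var j ^ r) = (0 :: 'k rat_fun)" by (simp add: s_def)
  with 1 have "(x_var (Suc n) :: 'k rat_fun) ^ r = x_var 1 ^ r" by (metis add_right_cancel)
  then show False using assms by (simp add: x_var_def indet_power_eq_iff)
qed

text \<open>For r < n the polynomial X^r is its own Lagrange interpolation at the x_j; compare the
  coefficients of X^i.\<close>

lemma x_basis_coeff_power_sum:
  assumes "r < n"
  shows "(\<Sum>j\<in>{1..n}. x_var j ^ r * Polynomial.coeff (x_basis n j) i) = (if i = r then 1 else 0 :: 'k::field rat_fun)"
proof -
  have "(\<Sum>j\<in>{1..n}. smult (x_var j ^ r) (x_basis n j)) = (Polynomial.monom 1 r :: 'k rat_fun Polynomial.poly)"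
  proof (rule poly_eqI_degree[of "x_var ` {1..n}"])
    fix w :: "'k rat_fun" assume "w \<in> x_var ` {1..n}"
    then obtain m where m: "m \<in> {1..n}" "w = x_var m" by auto
    have "poly (\<Sum>j\<in>{1..n}. smult (x_var j ^ r) (x_basis n j)) w = (\<Sum>j\<in>{1..n}. x_var j ^ r * (if m = j then 1 else 0))"
      unfolding poly_sum poly_smult m(2)
      by (intro sum.cong refl) (simp only: x_basis_poly[OF _ m(1)])
    also have "\<dots> = x_var m ^ r" using m by (simp add: if_distrib cong: if_cong)
    finally show "poly (\<Sum>j\<in>{1..n}. smult (x_var j ^ r) (x_basis n j)) w = poly (Polynomial.monom 1 r) w"
      by (simp add: poly_monom m)
  next
    have "Polynomial.degree (\<Sum>j\<in>{1..n}. smult (x_var j ^ r) (x_basis n j :: 'k rat_fun Polynomial.poly)) \<le> n - 1"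
    proof (rule degree_sum_le)
      fix j assume "j \<in> {1..n}"
      then show "Polynomial.degree (smult (x_var j ^ r) (x_basis n j :: 'k rat_fun Polynomial.poly)) \<le> n - 1"
        using x_basis_degree[of j n, where ?'k = 'k] degree_smult_le[of "x_var j ^ r" "x_basis n j :: 'k rat_fun Polynomial.poly"] by linarith
    qed simp
    then show "Polynomial.degree (\<Sum>j\<in>{1..n}. smult (x_var j ^ r) (x_basis n j :: 'k rat_fun Polynomial.poly)) < card (x_var ` {1..n} :: 'k rat_fun set)"
      using assms by (simp add: card_x_var)
  qed (use assms in \<open>simp add: card_x_var degree_monom_eq\<close>)
  from arg_cong[OF this, of "\<lambda>p. Polynomial.coeff p i"] show ?thesis
    by (auto simp: coeff_sum)
qed

lemma x_basis_coeff_inj: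
  assumes n: "n \<ge> 3" and pq: "p \<in> {1..n}" "q \<in> {1..n}" "p \<noteq> q" and i: "i < n"
  shows "Polynomial.coeff (x_basis n p) i \<noteq> (Polynomial.coeff (x_basis n q) i :: 'k::field rat_fun)"
proof
  define c where "c = (\<lambda>j. Polynomial.coeff (x_basis n j) i :: 'k rat_fun)"
  assume "Polynomial.coeff (x_basis n p) i = (Polynomial.coeff (x_basis n q) i :: 'k rat_fun)"
  then have eq: "c p = c q" by (simp add: c_def)
  \<comment> \<open>The transposition of q and j fixes p and turns c_p = c_q into c_p = c_j.\<close>
  have all: "c j = c p" if j: "j \<in> {1..n}" for j
  proof (cases "j = p")
    case False
    let ?\<sigma> = "transpose q j"
    have \<sigma>: "?\<sigma> permutes {1..n}" using j pq by (intro permutes_swap_id)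
    have id: "bij (\<lambda>i. i :: nat)" by (simp add: bij_id[unfolded id_def])
    have "c (?\<sigma> m) = perm_act ?\<sigma> (\<lambda>i. i) (c m)" if "m \<in> {1..n}" for m
      unfolding c_def by (rule perm_act_x_basis[OF \<sigma> id that, symmetric])
    from this[OF pq(1)] this[OF pq(2)] have "c (?\<sigma> p) = c (?\<sigma> q)" by (simp add: eq)
    moreover have "?\<sigma> p = p" "?\<sigma> q = j" using False pq by (auto simp: transpose_def)
    ultimately show ?thesis by simp
  qed simp
  \<comment> \<open>With all c_j equal, c_p times the r-th power sum is 1 for r = i and 0 for the
    other r < n.\<close>
  have ps: "(\<Sum>j\<in>{1..n}. x_var j ^ r) * c p = (if i = r then 1 else 0)" if "r < n" for r
  proof -
    have "(\<Sum>j\<in>{1..n}. x_var j ^ r * c j) = (if i = r then 1 else 0)"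
      unfolding c_def by (rule x_basis_coeff_power_sum[OF that])
    moreover have "(\<Sum>j\<in>{1..n}. x_var j ^ r * c j) = (\<Sum>j\<in>{1..n}. x_var j ^ r * c p)"
      by (intro sum.cong refl arg_cong2[of _ _ _ _ "(*)"] all)
    ultimately show ?thesis by (simp add: sum_distrib_right)
  qed
  have "c p \<noteq> 0" using ps[OF i] by auto
  \<comment> \<open>An exponent other than i among 1 and 2: it is positive, so the power sum is
    nonzero, and n \<ge> 3 puts it below n.\<close>
  define r :: nat where "r = (if i = 1 then 2 else 1)"
  have "r < n" "r > 0" "i \<noteq> r" using n by (auto simp: r_def)
  with ps[of r] \<open>c p \<noteq> 0\<close> have "(\<Sum>j\<in>{1..n}. x_var j ^ r) = (0 :: 'k rat_fun)" by simp
  then show False using power_sum_x_neq_0[of n r] n \<open>r > 0\<close> by auto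
qed

lemma u_coeff_in: "i < n \<Longrightarrow> u_coeff n i \<in> rat_fun_field n"
  by (simp add: u_coeff_eq poly_over_coeff[OF interp_xy_over])

text \<open>Reindexing keeps y_j in place and moves both permutations into the coefficients, so that
  the result can be compared with u_i one y_j at a time.\<close>

lemma perm_act_u_coeff:
  assumes \<sigma>: "\<sigma> permutes {1..n}" and \<tau>: "\<tau> permutes {1..n}" and i: "i < n"
  shows "perm_act \<sigma> \<tau> (u_coeff n i :: 'k::field rat_fun) =
    (\<Sum>j\<in>{1..n}. y_var j * Polynomial.coeff (x_basis n (\<sigma> (inv_fun \<tau> j))) i)"
proof -
  note bij = permutes_bij[OF \<sigma>] permutes_bij[OF \<tau>]
  let ?\<phi> = "perm_act \<sigma> \<tau> :: 'k rat_fun \<Rightarrow> _"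
  interpret field_map ?\<phi> by (rule field_map_perm_act[OF bij])
  have "?\<phi> (u_coeff n i) = (\<Sum>j\<in>{1..n}. y_var (\<tau> j) * Polynomial.coeff (x_basis n (\<sigma> j)) i)"
    unfolding u_coeff_sum[OF i] map_sum map_mult
    by (intro sum.cong refl) (simp only: perm_act_y[OF bij] perm_act_x_basis[OF \<sigma> bij(2)])
  also have "\<dots> = (\<Sum>j\<in>{1..n}. y_var (\<tau> j) * Polynomial.coeff (x_basis n (\<sigma> (inv_fun \<tau> (\<tau> j)))) i)"
    by (simp add: permutes_inverses[OF \<tau>])
  also have "\<dots> = (\<Sum>j\<in>{1..n}. y_var j * Polynomial.coeff (x_basis n (\<sigma> (inv_fun \<tau> j))) i)"
    by (rule sum.permute[OF \<tau>, of "\<lambda>j. y_var j * Polynomial.coeff (x_basis n (\<sigma> (inv_fun \<tau> j))) i",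
      unfolded o_def, symmetric])
  finally show ?thesis .
qed

lemma perm_act_u_coeff_eq_iff:
  assumes n: "n \<ge> 3" and \<sigma>: "\<sigma> permutes {1..n}" and \<tau>: "\<tau> permutes {1..n}" and i: "i < n"
  shows "perm_act \<sigma> \<tau> (u_coeff n i :: 'k::field rat_fun) = u_coeff n i \<longleftrightarrow> \<sigma> = \<tau>"
proof
  assume "\<sigma> = \<tau>"
  then show "perm_act \<sigma> \<tau> (u_coeff n i :: 'k rat_fun) = u_coeff n i"
    unfolding perm_act_u_coeff[OF \<sigma> \<tau> i] unfolding u_coeff_sum[OF i]
    by (simp add: permutes_inverses[OF \<tau>])
next
  assume eq: "perm_act \<sigma> \<tau> (u_coeff n i :: 'k rat_fun) = u_coeff n i"
  define d where "d j = Polynomial.coeff (x_basis n (\<sigma> (inv_fun \<tau> j))) i -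
    (Polynomial.coeff (x_basis n j) i :: 'k rat_fun)" for j
  have in': "\<sigma> (inv_fun \<tau> j) \<in> {1..n}" if "j \<in> {1..n}" for j
    using that permutes_in_image[OF \<sigma>] permutes_in_image[OF permutes_inv[OF \<tau>]] by simp
  have sum0: "(\<Sum>j\<in>{1..n}. y_var j * d j) = 0"
    using eq unfolding perm_act_u_coeff[OF \<sigma> \<tau> i] unfolding u_coeff_sum[OF i] d_def
    by (simp add: right_diff_distrib sum_subtractf)
  \<comment> \<open>The relation \<open>sum0\<close> is linear in y. Replacing y_m by y_{n+1}
    changes neither the d_j, which involve x only, nor the other summands; subtracting gives
    (y_{n+1} - y_m) d_m = 0.\<close>
  have d0: "d m = 0" if m: "m \<in> {1..n}" for m
  proof -
    let ?s = "transpose m (Suc n)"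
    have id: "(\<lambda>j. j) permutes {1..n}" by (rule permutes_id[unfolded id_def])
    have bij: "bij (\<lambda>j. j :: nat)" "bij ?s" by (simp_all add: bij_id[unfolded id_def])
    let ?\<phi> = "perm_act (\<lambda>j. j) ?s :: 'k rat_fun \<Rightarrow> _"
    interpret field_map ?\<phi> by (rule field_map_perm_act[OF bij])
    have dinv: "?\<phi> (d j) = d j" if "j \<in> {1..n}" for j
      unfolding d_def map_diff by (simp only: perm_act_x_basis[OF id bij(2)] in' that)
    have "?\<phi> (\<Sum>j\<in>{1..n}. y_var j * d j) = 0" by (simp only: sum0 map_zero)
    then have 1: "(\<Sum>j\<in>{1..n}. y_var (?s j) * d j) = 0"
      by (simp only: map_sum map_mult perm_act_y[OF bij] dinv cong: sum.cong)
    have rest: "(\<Sum>j\<in>{1..n} - {m}. y_var (?s j) * d j) = (\<Sum>j\<in>{1..n} - {m}. y_var j * d j)"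
      by (rule sum.cong) (auto simp: transpose_def)
    let ?R = "\<Sum>j\<in>{1..n} - {m}. y_var j * d j"
    have s1: "y_var (Suc n) * d m + ?R = 0"
      using 1 m unfolding sum.remove[OF finite_atLeastAtMost m] rest by simp
    have s2: "y_var m * d m + ?R = 0"
      using sum0 unfolding sum.remove[OF finite_atLeastAtMost m] .
    have "y_var (Suc n) * d m = y_var m * d m"
      by (rule add_right_imp_eq[OF trans[OF s1 s2[symmetric]]])
    moreover have "y_var (Suc n) \<noteq> (y_var m :: 'k rat_fun)" using m by (simp add: y_var_eq_iff)
    ultimately show ?thesis by simp
  qed
  have fixed: "\<sigma> (inv_fun \<tau> m) = m" if m: "m \<in> {1..n}" for m
    using d0[OF m] x_basis_coeff_inj[OF n in'[OF m] m _ i, where ?'k = 'k] by (auto simp: d_def)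
  show "\<sigma> = \<tau>"
  proof
    fix j
    show "\<sigma> j = \<tau> j"
    proof (cases "j \<in> {1..n}")
      case True
      then show ?thesis
        using fixed[of "\<tau> j"] permutes_in_image[OF \<tau>] by (simp add: permutes_inverses[OF \<tau>])
    next
      case False
      then show ?thesis by (metis permutes_not_in \<sigma> \<tau>)
    qed
  qed
qed

section \<open>The automorphism that exchanges x and y\<close>

definition swap_index :: "nat \<Rightarrow> nat" where
  "swap_index m = (if even m then m + 1 else m - 1)"

definition swap_xy :: "'k::field rat_fun \<Rightarrow> 'k rat_fun" where
  "swap_xy = rename swap_index"

lemma swap_index_swap_index: "swap_index \<circ> swap_index = id"
  by (auto simp: swap_index_def fun_eq_iff)

lemma bij_swap_index: "bij swap_index"
  by (rule o_bij) (rule swap_index_swap_index)+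

lemma field_map_swap_xy: "field_map swap_xy"
  unfolding swap_xy_def by (rule field_map_rename[OF bij_swap_index])

lemma swap_xy_x: "swap_xy (x_var i) = y_var i"
  and swap_xy_y: "swap_xy (y_var i) = x_var i"
  and swap_xy_const: "swap_xy (const_rf c) = const_rf c"
  by (simp_all add: swap_xy_def x_var_def y_var_def rename_indet rename_const bij_swap_index)
    (simp_all add: swap_index_def)

lemma swap_xy_closed: "a \<in> rat_fun_field n \<Longrightarrow> swap_xy a \<in> rat_fun_field n"
proof -
  interpret field_map "swap_xy :: 'a rat_fun \<Rightarrow> _" by (rule field_map_swap_xy)
  let ?L = "rat_fun_field n :: 'a rat_fun set"
  have "?L \<subseteq> swap_xy -` ?L"
    unfolding rat_fun_field_def[of n]
    by (intro adjoin_least subfield_vimage subfield_adjoin; fold rat_fun_field_def)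
      (auto simp: swap_xy_x swap_xy_y swap_xy_const rat_fun_field_gens)
  then show "a \<in> rat_fun_field n \<Longrightarrow> swap_xy a \<in> rat_fun_field n" by auto
qed

lemma perm_act_swap_xy:
  assumes "bij \<sigma>" "bij \<tau>"
  shows "perm_act \<sigma> \<tau> (swap_xy a) = swap_xy (perm_act \<tau> \<sigma> a)"
proof -
  have "rename_pair \<sigma> \<tau> \<circ> swap_index = swap_index \<circ> rename_pair \<tau> \<sigma>"
    by (auto simp: rename_pair_def swap_index_def fun_eq_iff elim!: oddE)
  then show ?thesis
    using assms by (simp add: perm_act_def swap_xy_def rename_compose bij_rename_pair bij_swap_index)
qed

text \<open>The exchange turns the polynomial with values y_j at x_j into one with values x_j at
  y_j, and the latter is unique.\<close>

lemma v_coeff_eq: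
  assumes "i < n"
  shows "v_coeff n i = (swap_xy (u_coeff n i) :: 'k::field rat_fun)"
proof -
  interpret field_map "swap_xy :: 'k rat_fun \<Rightarrow> _" by (rule field_map_swap_xy)
  let ?P = "map_poly swap_xy (interp_xy n) :: 'k rat_fun Polynomial.poly"
  have "v_coeff n i = Polynomial.coeff ?P i"
    unfolding v_coeff_def
  proof (rule interp_coeffs_eq)
    show "?P \<in> poly_over (rat_fun_field n)"
      by (simp add: poly_over_def coeff_map_poly map_zero swap_xy_closed poly_over_coeff[OF interp_xy_over])
    show "Polynomial.degree ?P < n" using assms by (simp add: degree_map_poly' interp_xy_degree)
    show "poly ?P (y_var j) = x_var j" if "j \<in> {1..n}" for j
      using poly_map_poly[of "interp_xy n" "x_var j"] that by (simp add: interp_xy_poly swap_xy_x swap_xy_y)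
  qed (use assms in \<open>auto simp: inj_on_def y_var_eq_iff\<close>)
  then show ?thesis by (simp add: coeff_map_poly map_zero u_coeff_eq assms)
qed

text \<open>The property through which u_i and v_i are treated alike. It is symmetric in the two
  permutations, so the exchange of x and y preserves it.\<close>

definition diag_stabilized :: "nat \<Rightarrow> 'k::field rat_fun \<Rightarrow> bool" where
  "diag_stabilized n t \<longleftrightarrow> t \<in> rat_fun_field n \<and>
    (\<forall>\<alpha> \<beta>. \<alpha> permutes {1..n} \<longrightarrow> \<beta> permutes {1..n} \<longrightarrow> (perm_act \<alpha> \<beta> t = t \<longleftrightarrow> \<alpha> = \<beta>))"

lemma diag_stabilized_u: "n \<ge> 3 \<Longrightarrow> i < n \<Longrightarrow> diag_stabilized n (u_coeff n i)"
  unfolding diag_stabilized_def using perm_act_u_coeff_eq_iff u_coeff_in by blast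

lemma diag_stabilized_v:
  assumes "n \<ge> 3" "i < n"
  shows "diag_stabilized n (v_coeff n i)"
proof -
  interpret field_map "swap_xy :: 'a rat_fun \<Rightarrow> _" by (rule field_map_swap_xy)
  show ?thesis
    using assms perm_act_u_coeff_eq_iff[OF assms(1) _ _ assms(2)]
    by (auto simp: diag_stabilized_def v_coeff_eq u_coeff_in swap_xy_closed perm_act_swap_xy permutes_bij inj_eq[OF inj_map])
qed

section \<open>Conjugates of elements with diagonal stabilizer\<close>

lemma permutes_conj:
  "\<sigma> permutes S \<Longrightarrow> \<pi> permutes S \<Longrightarrow> \<sigma> \<circ> \<pi> \<circ> inv_fun \<sigma> permutes S"
  by (intro permutes_compose permutes_inv)

context
  fixes n :: nat and \<sigma> \<tau> :: "nat \<Rightarrow> nat" and t :: "'k::field rat_fun"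
  assumes \<sigma>: "\<sigma> permutes {1..n}" and \<tau>: "\<tau> permutes {1..n}" and t: "diag_stabilized n t"
begin

text \<open>The stabilizer of a conjugate is the conjugate stabilizer: pull the equation back to
  \<open>t\<close>, where being fixed means being diagonal.\<close>

lemma conj_stabilizer:
  assumes \<alpha>: "\<alpha> permutes {1..n}" and \<beta>: "\<beta> permutes {1..n}"
  shows "perm_act \<alpha> \<beta> (perm_act \<sigma> \<tau> t) = perm_act \<sigma> \<tau> t \<longleftrightarrow>
    (\<exists>\<pi>. \<pi> permutes {1..n} \<and> \<alpha> = \<sigma> \<circ> \<pi> \<circ> inv_fun \<sigma> \<and> \<beta> = \<tau> \<circ> \<pi> \<circ> inv_fun \<tau>)"
proof -
  note bij = permutes_bij[OF \<sigma>] permutes_bij[OF \<tau>] permutes_bij[OF \<alpha>] permutes_bij[OF \<beta>]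
  let ?\<alpha> = "inv_fun \<sigma> \<circ> (\<alpha> \<circ> \<sigma>)" and ?\<beta> = "inv_fun \<tau> \<circ> (\<beta> \<circ> \<tau>)"
  have p: "?\<alpha> permutes {1..n}" "?\<beta> permutes {1..n}"
    by (intro permutes_compose permutes_inv \<sigma> \<tau> \<alpha> \<beta>)+
  have "perm_act \<alpha> \<beta> (perm_act \<sigma> \<tau> t) = perm_act \<sigma> \<tau> t \<longleftrightarrow>
      perm_act (inv_fun \<sigma>) (inv_fun \<tau>) (perm_act \<alpha> \<beta> (perm_act \<sigma> \<tau> t)) = t"
    using perm_act_inv[OF bij(1,2)] by metis
  also have "perm_act (inv_fun \<sigma>) (inv_fun \<tau>) (perm_act \<alpha> \<beta> (perm_act \<sigma> \<tau> t)) = perm_act ?\<alpha> ?\<beta> t"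
    using bij by (simp add: perm_act_compose bij_imp_bij_inv bij_comp)
  also have "\<dots> = t \<longleftrightarrow> ?\<alpha> = ?\<beta>"
    using t p by (simp add: diag_stabilized_def)
  also have "\<dots> \<longleftrightarrow> (\<exists>\<pi>. \<pi> permutes {1..n} \<and> \<alpha> = \<sigma> \<circ> \<pi> \<circ> inv_fun \<sigma> \<and> \<beta> = \<tau> \<circ> \<pi> \<circ> inv_fun \<tau>)"
  proof
    assume eq: "?\<alpha> = ?\<beta>"
    have "\<alpha> = \<sigma> \<circ> ?\<alpha> \<circ> inv_fun \<sigma>" "\<beta> = \<tau> \<circ> ?\<beta> \<circ> inv_fun \<tau>"
      by (simp_all add: fun_eq_iff permutes_inverses[OF \<sigma>] permutes_inverses[OF \<tau>])
    then show "\<exists>\<pi>. \<pi> permutes {1..n} \<and> \<alpha> = \<sigma> \<circ> \<pi> \<circ> inv_fun \<sigma> \<and> \<beta> = \<tau> \<circ> \<pi> \<circ> inv_fun \<tau>"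
      using p(1) eq by (intro exI[of _ ?\<alpha>]) simp
  next
    assume "\<exists>\<pi>. \<pi> permutes {1..n} \<and> \<alpha> = \<sigma> \<circ> \<pi> \<circ> inv_fun \<sigma> \<and> \<beta> = \<tau> \<circ> \<pi> \<circ> inv_fun \<tau>"
    then show "?\<alpha> = ?\<beta>"
      by (auto simp: fun_eq_iff permutes_inverses[OF \<sigma>] permutes_inverses[OF \<tau>])
  qed
  finally show ?thesis .
qed

lemma invariants_conj:
  "invariants_of_stabilizer n (perm_act \<sigma> \<tau> t) = {a \<in> rat_fun_field n. \<forall>\<pi>. \<pi> permutes {1..n} \<longrightarrow>
      perm_act (\<sigma> \<circ> \<pi> \<circ> inv_fun \<sigma>) (\<tau> \<circ> \<pi> \<circ> inv_fun \<tau>) a = a}"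
proof -
  have "(\<forall>\<alpha> \<beta>. \<alpha> permutes {1..n} \<longrightarrow> \<beta> permutes {1..n} \<longrightarrow>
      perm_act \<alpha> \<beta> (perm_act \<sigma> \<tau> t) = perm_act \<sigma> \<tau> t \<longrightarrow> perm_act \<alpha> \<beta> a = a) \<longleftrightarrow>
    (\<forall>\<pi>. \<pi> permutes {1..n} \<longrightarrow> perm_act (\<sigma> \<circ> \<pi> \<circ> inv_fun \<sigma>) (\<tau> \<circ> \<pi> \<circ> inv_fun \<tau>) a = a)"
    (is "?l \<longleftrightarrow> ?r") for a :: "'k rat_fun"
  proof
    assume l: ?l
    show ?r
    proof (intro allI impI)
      fix \<pi> assume p: "\<pi> permutes {1..n}"
      note c = permutes_conj[OF \<sigma> p] permutes_conj[OF \<tau> p]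
      have "perm_act (\<sigma> \<circ> \<pi> \<circ> inv_fun \<sigma>) (\<tau> \<circ> \<pi> \<circ> inv_fun \<tau>) (perm_act \<sigma> \<tau> t) = perm_act \<sigma> \<tau> t"
        unfolding conj_stabilizer[OF c] using p by blast
      then show "perm_act (\<sigma> \<circ> \<pi> \<circ> inv_fun \<sigma>) (\<tau> \<circ> \<pi> \<circ> inv_fun \<tau>) a = a"
        using l c by blast
    qed
  next
    assume r: ?r
    show ?l
    proof (intro allI impI)
      fix \<alpha> \<beta> assume ab: "\<alpha> permutes {1..n}" "\<beta> permutes {1..n}"
        "perm_act \<alpha> \<beta> (perm_act \<sigma> \<tau> t) = perm_act \<sigma> \<tau> t"
      from ab(3) obtain \<pi> where "\<pi> permutes {1..n}" "\<alpha> = \<sigma> \<circ> \<pi> \<circ> inv_fun \<sigma>" "\<beta> = \<tau> \<circ> \<pi> \<circ> inv_fun \<tau>"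
        unfolding conj_stabilizer[OF ab(1,2)] by blast
      then show "perm_act \<alpha> \<beta> a = a" using r by simp
    qed
  qed
  then show ?thesis by (simp only: invariants_of_stabilizer_def)
qed

text \<open>The index of the diagonal is (n!)^2 / n!. Concretely, each of its left cosets contains
  exactly one pair with first component the identity, so the second component parametrizes the
  orbit.\<close>

lemma card_orbit_conj: "card (orbit_of n (perm_act \<sigma> \<tau> t)) = fact n"
proof -
  have id: "(\<lambda>j. j) permutes {1..n}" by (rule permutes_id[unfolded id_def])
  let ?w = "perm_act \<sigma> \<tau> t"
  let ?S = "{\<beta>. \<beta> permutes {1..n}}"
  have "orbit_of n ?w = (\<lambda>\<beta>. perm_act (\<lambda>j. j) \<beta> t) ` ?S"
  proof (intro equalityI subsetI)
    fix v assume "v \<in> orbit_of n ?w"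
    then obtain \<alpha> \<beta> where ab: "\<alpha> permutes {1..n}" "\<beta> permutes {1..n}" "v = perm_act \<alpha> \<beta> ?w"
      by (auto simp: orbit_of_def perm_pairs_def)
    \<comment> \<open>Factor (\<alpha> \<circ> \<sigma>, \<beta> \<circ> \<tau>) as (id, \<delta>)
      after (\<gamma>, \<gamma>); the diagonal factor fixes \<open>t\<close>.\<close>
    define \<gamma> where "\<gamma> = \<alpha> \<circ> \<sigma>"
    define \<delta> where "\<delta> = \<beta> \<circ> \<tau> \<circ> inv_fun \<gamma>"
    have g: "\<gamma> permutes {1..n}" unfolding \<gamma>_def using ab \<sigma> by (auto intro: permutes_compose)
    have d: "\<delta> permutes {1..n}" unfolding \<delta>_def using ab \<tau> g by (auto intro: permutes_compose permutes_inv)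
    have "perm_act \<gamma> \<gamma> t = t" using t g by (simp add: diag_stabilized_def)
    moreover have "perm_act (\<lambda>j. j) \<delta> (perm_act \<gamma> \<gamma> t) = perm_act ((\<lambda>j. j) \<circ> \<gamma>) (\<delta> \<circ> \<gamma>) t"
      by (rule perm_act_compose) (use id g d in \<open>auto intro: permutes_bij\<close>)
    moreover have "(\<lambda>j. j) \<circ> \<gamma> = \<alpha> \<circ> \<sigma>" "\<delta> \<circ> \<gamma> = \<beta> \<circ> \<tau>"
      by (simp_all add: fun_eq_iff \<delta>_def permutes_inverses[OF g]) (simp add: \<gamma>_def)
    moreover have "v = perm_act (\<alpha> \<circ> \<sigma>) (\<beta> \<circ> \<tau>) t"
      unfolding ab(3) by (rule perm_act_compose) (use ab \<sigma> \<tau> in \<open>auto intro: permutes_bij\<close>)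
    ultimately have "v = perm_act (\<lambda>j. j) \<delta> t" by simp
    then show "v \<in> (\<lambda>\<beta>. perm_act (\<lambda>j. j) \<beta> t) ` ?S" using d by blast
  next
    fix v assume "v \<in> (\<lambda>\<beta>. perm_act (\<lambda>j. j) \<beta> t) ` ?S"
    then obtain \<beta> where b: "\<beta> permutes {1..n}" "v = perm_act (\<lambda>j. j) \<beta> t" by blast
    \<comment> \<open>This pair undoes (\<sigma>, \<tau>) and then applies (id, \<beta>).\<close>
    have p: "inv_fun \<sigma> permutes {1..n}" "\<beta> \<circ> inv_fun \<tau> permutes {1..n}"
      by (intro permutes_compose permutes_inv \<sigma> \<tau> b)+
    have "perm_act (inv_fun \<sigma>) (\<beta> \<circ> inv_fun \<tau>) ?w = perm_act (inv_fun \<sigma> \<circ> \<sigma>) (\<beta> \<circ> inv_fun \<tau> \<circ> \<tau>) t"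
      by (rule perm_act_compose) (use p \<sigma> \<tau> in \<open>auto intro: permutes_bij\<close>)
    moreover have "inv_fun \<sigma> \<circ> \<sigma> = (\<lambda>j. j)" "\<beta> \<circ> inv_fun \<tau> \<circ> \<tau> = \<beta>"
      by (simp_all add: fun_eq_iff permutes_inverses[OF \<sigma>] permutes_inverses[OF \<tau>])
    ultimately have "v = perm_act (inv_fun \<sigma>) (\<beta> \<circ> inv_fun \<tau>) ?w" using b by simp
    then show "v \<in> orbit_of n ?w"
      using p by (auto simp: orbit_of_def perm_pairs_def)
  qed
  moreover have "inj_on (\<lambda>\<beta>. perm_act (\<lambda>j. j) \<beta> t) ?S"
  proof (rule inj_onI)
    fix \<beta> \<gamma> assume bg: "\<beta> \<in> ?S" "\<gamma> \<in> ?S" "perm_act (\<lambda>j. j) \<beta> t = perm_act (\<lambda>j. j) \<gamma> t"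
    then have b: "\<beta> permutes {1..n}" and g: "\<gamma> permutes {1..n}" by auto
    have "perm_act (\<lambda>j. j) (inv_fun \<gamma>) (perm_act (\<lambda>j. j) \<delta> t) = perm_act ((\<lambda>j. j) \<circ> (\<lambda>j. j)) (inv_fun \<gamma> \<circ> \<delta>) t"
      if "\<delta> permutes {1..n}" for \<delta>
      by (rule perm_act_compose) (use id that permutes_inv[OF g] in \<open>auto intro: permutes_bij\<close>)
    from this[OF b] this[OF g]
    have "perm_act (\<lambda>j. j) (inv_fun \<gamma> \<circ> \<beta>) t = perm_act (\<lambda>j. j) (\<lambda>j. j) t"
      using bg(3) by (simp add: o_def permutes_inverses[OF g])
    then have "perm_act (\<lambda>j. j) (inv_fun \<gamma> \<circ> \<beta>) t = t" by (simp add: perm_act_id)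
    moreover have "inv_fun \<gamma> \<circ> \<beta> permutes {1..n}"
      by (intro permutes_compose permutes_inv b g)
    \<comment> \<open>A diagonal pair with first component the identity is trivial.\<close>
    ultimately have "inv_fun \<gamma> \<circ> \<beta> = (\<lambda>j. j)"
      using t id by (metis diag_stabilized_def)
    then show "\<beta> = \<gamma>"
      by (metis (no_types, lifting) comp_apply ext permutes_inverses(1)[OF g])
  qed
  ultimately show ?thesis
    by (simp add: card_image card_permutations)
qed

lemma dimension_conj:
  "ring.dimension rat_fun_ring (fact n) (base_field n) (adjoin (base_field n) {perm_act \<sigma> \<tau> t})"
proof -
  have "perm_act \<sigma> \<tau> t \<in> rat_fun_field n"
    by (rule perm_act_rat_fun_field[OF \<sigma> \<tau>]) (use t in \<open>simp add: diag_stabilized_def\<close>)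
  from adjoin_eq(2)[OF this] dimension_poly_values[OF order_refl, of n "perm_act \<sigma> \<tau> t"] show ?thesis
    by (simp add: card_orbit_conj)
qed

end

theorem proposition2p2:
  fixes n i :: nat and g :: "'k::field rat_fun \<Rightarrow> 'k rat_fun"
  assumes "n \<ge> 3" and "i < n" and "g \<in> carrier (G_st n)"
  shows "fixed_field (adjoin (L_s n) (L_t n))
           (inv\<^bsub>G_st n\<^esub> g <#\<^bsub>G_st n\<^esub> diag_subgroup n #>\<^bsub>G_st n\<^esub> g)
         = adjoin (base_field n) ((\<lambda>j. g (u_coeff n j)) ` {..<n}) \<and>
         adjoin (base_field n) ((\<lambda>j. g (u_coeff n j)) ` {..<n})
         = adjoin (base_field n) ((\<lambda>j. g (v_coeff n j)) ` {..<n}) \<and>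
         adjoin (base_field n) ((\<lambda>j. g (v_coeff n j)) ` {..<n})
         = adjoin (base_field n) {g (u_coeff n i)} \<and>
         adjoin (base_field n) {g (u_coeff n i)} = adjoin (base_field n) {g (v_coeff n i)} \<and>
         ring.dimension rat_fun_ring (fact n) (base_field n)
           (adjoin (base_field n) {g (u_coeff n i)})"
proof -
  let ?K = "base_field n :: 'k rat_fun set"
  obtain \<sigma> \<tau> where st: "\<sigma> permutes {1..n}" "\<tau> permutes {1..n}"
    and g: "g = restrict (perm_act \<sigma> \<tau>) (rat_fun_field n)"
    using G_st_carrierE[OF assms(3)] .
  \<comment> \<open>Every field in the chain of equalities is shown to be this one.\<close>
  define F where "F = fixed_field (rat_fun_field n)
    (inv\<^bsub>G_st n\<^esub> g <#\<^bsub>G_st n\<^esub> diag_subgroup n #>\<^bsub>G_st n\<^esub> g)"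
  have inv: "invariants_of_stabilizer n (perm_act \<sigma> \<tau> t) = F" if "diag_stabilized n t" for t
    unfolding F_def g fixed_field_conj_diag[OF st] by (rule invariants_conj[OF st that])
  have single: "adjoin ?K {g t} = F" and mem: "g t \<in> F" if t: "diag_stabilized n t" for t
  proof -
    have tL: "t \<in> rat_fun_field n" using t by (simp add: diag_stabilized_def)
    then have gt: "g t = perm_act \<sigma> \<tau> t" by (simp add: g)
    show "adjoin ?K {g t} = F"
      unfolding gt adjoin_eq(1)[OF perm_act_rat_fun_field[OF st tL]] by (rule inv[OF t])
    then show "g t \<in> F" by (metis adjoin_genI singletonI)
  qed
  \<comment> \<open>All generators lie in \<open>F\<close>, and the one with index \<open>i\<close>
    alone already generates it.\<close>
  have all: "adjoin ?K ((\<lambda>j. g (t j)) ` {..<n}) = F"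
    if t: "\<And>j. j < n \<Longrightarrow> diag_stabilized n (t j)" for t
  proof
    have "(\<lambda>j. g (t j)) ` {..<n} \<subseteq> F" by (auto intro: mem t)
    then show "adjoin ?K ((\<lambda>j. g (t j)) ` {..<n}) \<subseteq> F"
      unfolding inv[OF t[OF assms(2)], symmetric] by (rule adjoin_subset_invariants)
    show "F \<subseteq> adjoin ?K ((\<lambda>j. g (t j)) ` {..<n})"
      unfolding single[OF t[OF assms(2)], symmetric]
      by (rule adjoin_least[OF subfield_adjoin])
        (use assms(2) in \<open>auto intro: adjoin_baseI adjoin_genI\<close>)
  qed
  have u: "diag_stabilized n (u_coeff n j :: 'k rat_fun)" and v: "diag_stabilized n (v_coeff n j :: 'k rat_fun)"
    if "j < n" for j
    using diag_stabilized_u[OF assms(1) that] diag_stabilized_v[OF assms(1) that] .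
  have "g (u_coeff n i) = perm_act \<sigma> \<tau> (u_coeff n i)"
    by (simp add: g u_coeff_in[OF assms(2)])
  then have "ring.dimension rat_fun_ring (fact n) ?K (adjoin ?K {g (u_coeff n i)})"
    using dimension_conj[OF st u[OF assms(2)]] by simp
  then show ?thesis
    unfolding adjoin_L_s_L_t F_def[symmetric]
    by (simp add: all u v single assms(2))
qed

end
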